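(* Let $G$ be a finite group which is a Schur cover of some group. Then the irreducible quandle representations of $Conj(G)$ over $\mathbb{C}$ are exactly the representations $\chi\cdot\rho'$, where $\rho'$ is an irreducible complex linear representation of the group $G$ (viewed as a quandle representation of $Conj(G)$) and $\chi$ is a character of the quandle $Conj(G)$.
   Context: For a group $G$, $Conj(G)$ is the quandle with underlying set $G$ and operation $x\triangleright y=xyx^{-1}$. A finite group $G$ is a Schur cover of a group $H$ if there is a surjective morphism $\theta:G\to H$ such that $\ker(\theta)$ is contained in the center of $G$ and in the derived subgroup of $G$, and $\ker(\theta)\simeq H^2(H,\mathbb{C}^\times)$ (group cohomology with trivial action on $\mathbb{C}^\times$). A quandle representation of a quandle $Q$ on a complex vector space $V$ is a map $\rho:Q\to GL(V)$ with $\rho(x\triangleright y)=\rho(x)\rho(y)\rho(x)^{-1}$ for all $x,y\in Q$. A subrepresentation is a subspace $W\subset V$ with $\rho(x)(W)\subset W$ for all $x\in Q$; $\rho$ is irreducible if $V\neq 0$ and its only subrepresentations are $0$ and $V$. A character of a quandle $Q$ is a map $\chi:Q\to\mathbb{C}^\times$ with $\chi(x\triangleright y)=\chi(y)$ for all $x,y\in Q$; for a quandle representation $\rho$, $(\chi\cdot\rho)(x)=\chi(x)\rho(x)$. A group representation of $G$ is in particular a quandle representation of $Conj(G)$. *)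

theory Defs
  imports Complex_Main "HOL-Algebra.Product_Groups" "HOL-Algebra.Generated_Groups"
begin

section \<open>Quandles\<close>

record 'a quandle_struct = "'a partial_object" +
  qop :: "'a \<Rightarrow> 'a \<Rightarrow> 'a"

locale quandle =
  fixes Q :: "('a, 'm) quandle_struct_scheme"
  assumes qop_bij: "x \<in> carrier Q \<Longrightarrow> bij_betw (qop Q x) (carrier Q) (carrier Q)"
    and qop_distrib: "\<lbrakk>x \<in> carrier Q; y \<in> carrier Q; z \<in> carrier Q\<rbrakk> \<Longrightarrow>
          qop Q x (qop Q y z) = qop Q (qop Q x y) (qop Q x z)"
    and qop_idem: "x \<in> carrier Q \<Longrightarrow> qop Q x x = x"

definition Conj :: "('g, 'm) monoid_scheme \<Rightarrow> 'g quandle_struct" where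
  "Conj G = \<lparr>carrier = carrier G, qop = (\<lambda>x y. x \<otimes>\<^bsub>G\<^esub> y \<otimes>\<^bsub>G\<^esub> inv\<^bsub>G\<^esub> x)\<rparr>"

definition quandle_character :: "('a, 'm) quandle_struct_scheme \<Rightarrow> ('a \<Rightarrow> complex) \<Rightarrow> bool" where
  "quandle_character Q \<chi> \<longleftrightarrow>
     \<chi> \<in> carrier Q \<rightarrow> UNIV - {0} \<and>
     (\<forall>x\<in>carrier Q. \<forall>y\<in>carrier Q. \<chi> (qop Q x y) = \<chi> y)"


section \<open>Representations\<close>

text \<open>
  A complex vector space is a type \<open>'v\<close> together with a scalar multiplication \<open>s\<close> such that
  \<open>vector_space s\<close>; its dimension is not assumed to be finite.
\<close>

definition GL :: "(complex \<Rightarrow> 'v::ab_group_add \<Rightarrow> 'v) \<Rightarrow> ('v \<Rightarrow> 'v) monoid" where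
  "GL s = \<lparr>carrier = {f. Vector_Spaces.linear s s f \<and> bij f}, mult = (\<circ>), one = id\<rparr>"

definition quandle_rep ::
  "(complex \<Rightarrow> 'v::ab_group_add \<Rightarrow> 'v) \<Rightarrow> ('a, 'm) quandle_struct_scheme \<Rightarrow> ('a \<Rightarrow> 'v \<Rightarrow> 'v) \<Rightarrow> bool" where
  "quandle_rep s Q \<rho> \<longleftrightarrow>
     \<rho> \<in> carrier Q \<rightarrow> carrier (GL s) \<and>
     (\<forall>x\<in>carrier Q. \<forall>y\<in>carrier Q. \<rho> (qop Q x y) = \<rho> x \<otimes>\<^bsub>GL s\<^esub> \<rho> y \<otimes>\<^bsub>GL s\<^esub> inv\<^bsub>GL s\<^esub> (\<rho> x))"

definition invariant_subspace ::
  "(complex \<Rightarrow> 'v::ab_group_add \<Rightarrow> 'v) \<Rightarrow> 'a set \<Rightarrow> ('a \<Rightarrow> 'v \<Rightarrow> 'v) \<Rightarrow> 'v set \<Rightarrow> bool" where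
  "invariant_subspace s X \<rho> W \<longleftrightarrow> Modules.module.subspace s W \<and> (\<forall>x\<in>X. \<rho> x ` W \<subseteq> W)"

definition irreducible_action ::
  "(complex \<Rightarrow> 'v::ab_group_add \<Rightarrow> 'v) \<Rightarrow> 'a set \<Rightarrow> ('a \<Rightarrow> 'v \<Rightarrow> 'v) \<Rightarrow> bool" where
  "irreducible_action s X \<rho> \<longleftrightarrow>
     (UNIV :: 'v set) \<noteq> {0} \<and>
     (\<forall>W. invariant_subspace s X \<rho> W \<longrightarrow> W = {0} \<or> W = UNIV)"

definition irreducible_quandle_rep ::
  "(complex \<Rightarrow> 'v::ab_group_add \<Rightarrow> 'v) \<Rightarrow> ('a, 'm) quandle_struct_scheme \<Rightarrow> ('a \<Rightarrow> 'v \<Rightarrow> 'v) \<Rightarrow> bool" where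
  "irreducible_quandle_rep s Q \<rho> \<longleftrightarrow> quandle_rep s Q \<rho> \<and> irreducible_action s (carrier Q) \<rho>"

definition irreducible_group_rep ::
  "(complex \<Rightarrow> 'v::ab_group_add \<Rightarrow> 'v) \<Rightarrow> ('g, 'm) monoid_scheme \<Rightarrow> ('g \<Rightarrow> 'v \<Rightarrow> 'v) \<Rightarrow> bool" where
  "irreducible_group_rep s G \<rho> \<longleftrightarrow> \<rho> \<in> hom G (GL s) \<and> irreducible_action s (carrier G) \<rho>"

definition twist ::
  "(complex \<Rightarrow> 'v \<Rightarrow> 'v) \<Rightarrow> ('a \<Rightarrow> complex) \<Rightarrow> ('a \<Rightarrow> 'v \<Rightarrow> 'v) \<Rightarrow> 'a \<Rightarrow> 'v \<Rightarrow> 'v" where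
  "twist s \<chi> \<rho> x = (\<lambda>v. s (\<chi> x) (\<rho> x v))"


section \<open>The second cohomology group with trivial action\<close>

text \<open>
  Inhomogeneous cochains with values in an abelian group \<open>A\<close>, written multiplicatively, on which
  \<open>H\<close> acts trivially.
\<close>

definition cochains2 ::
  "('h, 'm) monoid_scheme \<Rightarrow> ('c, 'n) monoid_scheme \<Rightarrow> ('h \<times> 'h \<Rightarrow> 'c) monoid" where
  "cochains2 H A = product_group (carrier H \<times> carrier H) (\<lambda>_. A)"

definition cocycles2 ::
  "('h, 'm) monoid_scheme \<Rightarrow> ('c, 'n) monoid_scheme \<Rightarrow> ('h \<times> 'h \<Rightarrow> 'c) set" where
  "cocycles2 H A =
     {f \<in> carrier (cochains2 H A). \<forall>x\<in>carrier H. \<forall>y\<in>carrier H. \<forall>z\<in>carrier H.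
        f (y, z) \<otimes>\<^bsub>A\<^esub> f (x, y \<otimes>\<^bsub>H\<^esub> z) = f (x \<otimes>\<^bsub>H\<^esub> y, z) \<otimes>\<^bsub>A\<^esub> f (x, y)}"

definition coboundary ::
  "('h, 'm) monoid_scheme \<Rightarrow> ('c, 'n) monoid_scheme \<Rightarrow> ('h \<Rightarrow> 'c) \<Rightarrow> 'h \<times> 'h \<Rightarrow> 'c" where
  "coboundary H A c =
     (\<lambda>(x, y)\<in>carrier H \<times> carrier H. c y \<otimes>\<^bsub>A\<^esub> inv\<^bsub>A\<^esub> (c (x \<otimes>\<^bsub>H\<^esub> y)) \<otimes>\<^bsub>A\<^esub> c x)"

definition coboundaries2 ::
  "('h, 'm) monoid_scheme \<Rightarrow> ('c, 'n) monoid_scheme \<Rightarrow> ('h \<times> 'h \<Rightarrow> 'c) set" where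
  "coboundaries2 H A = coboundary H A ` (carrier H \<rightarrow> carrier A)"

definition H2 ::
  "('h, 'm) monoid_scheme \<Rightarrow> ('c, 'n) monoid_scheme \<Rightarrow> ('h \<times> 'h \<Rightarrow> 'c) set monoid" where
  "H2 H A = (cochains2 H A)\<lparr>carrier := cocycles2 H A\<rparr> Mod coboundaries2 H A"

definition complex_units :: "complex monoid" where
  "complex_units = \<lparr>carrier = UNIV - {0}, mult = (*), one = 1\<rparr>"


section \<open>Schur covers\<close>

definition group_center :: "('g, 'm) monoid_scheme \<Rightarrow> 'g set" where
  "group_center G = {z \<in> carrier G. \<forall>g\<in>carrier G. z \<otimes>\<^bsub>G\<^esub> g = g \<otimes>\<^bsub>G\<^esub> z}"

definition schur_cover :: "('g, 'm) monoid_scheme \<Rightarrow> ('h, 'n) monoid_scheme \<Rightarrow> bool" where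
  "schur_cover G H \<longleftrightarrow>
     group G \<and> finite (carrier G) \<and> group H \<and>
     (\<exists>\<theta> \<in> epi G H.
        kernel G H \<theta> \<subseteq> group_center G \<and>
        kernel G H \<theta> \<subseteq> derived G (carrier G) \<and>
        G\<lparr>carrier := kernel G H \<theta>\<rparr> \<cong> H2 H complex_units)"


section \<open>Well-definedness\<close>

lemma quandle_Conj:
  assumes "group G"
  shows "quandle (Conj G)"
proof -
  interpret group G by fact
  have cancel: "inv\<^bsub>G\<^esub> x \<otimes>\<^bsub>G\<^esub> (x \<otimes>\<^bsub>G\<^esub> u) = u" "x \<otimes>\<^bsub>G\<^esub> (inv\<^bsub>G\<^esub> x \<otimes>\<^bsub>G\<^esub> u) = u"
    if "x \<in> carrier G" "u \<in> carrier G" for x u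
    using that by (simp_all flip: m_assoc)
  have bij: "bij_betw (\<lambda>y. x \<otimes>\<^bsub>G\<^esub> y \<otimes>\<^bsub>G\<^esub> inv\<^bsub>G\<^esub> x) (carrier G) (carrier G)" if "x \<in> carrier G" for x
    by (rule bij_betw_byWitness[where f' = "\<lambda>y. inv\<^bsub>G\<^esub> x \<otimes>\<^bsub>G\<^esub> y \<otimes>\<^bsub>G\<^esub> x"])
       (use that in \<open>auto simp: m_assoc cancel\<close>)
  have distrib: "x \<otimes>\<^bsub>G\<^esub> (y \<otimes>\<^bsub>G\<^esub> z \<otimes>\<^bsub>G\<^esub> inv\<^bsub>G\<^esub> y) \<otimes>\<^bsub>G\<^esub> inv\<^bsub>G\<^esub> x =
      (x \<otimes>\<^bsub>G\<^esub> y \<otimes>\<^bsub>G\<^esub> inv\<^bsub>G\<^esub> x) \<otimes>\<^bsub>G\<^esub> (x \<otimes>\<^bsub>G\<^esub> z \<otimes>\<^bsub>G\<^esub> inv\<^bsub>G\<^esub> x) \<otimes>\<^bsub>G\<^esub> inv\<^bsub>G\<^esub> (x \<otimes>\<^bsub>G\<^esub> y \<otimes>\<^bsub>G\<^esub> inv\<^bsub>G\<^esub> x)"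
    if "x \<in> carrier G" "y \<in> carrier G" "z \<in> carrier G" for x y z
    using that by (simp add: m_assoc inv_mult_group cancel)
  have idem: "x \<otimes>\<^bsub>G\<^esub> x \<otimes>\<^bsub>G\<^esub> inv\<^bsub>G\<^esub> x = x" if "x \<in> carrier G" for x
    using that by (simp add: m_assoc)
  show ?thesis
    by unfold_locales (use bij in \<open>simp add: Conj_def\<close>, unfold Conj_def, simp_all only: quandle_struct.simps partial_object.simps distrib idem)
qed

lemma group_GL:
  assumes "vector_space s"
  shows "group (GL s)"
proof -
  interpret vector_space s by fact
  interpret vector_space_pair s s by unfold_locales
  have inv: "Vector_Spaces.linear s s (Hilbert_Choice.inv f)" if "Vector_Spaces.linear s s f" "bij f" for f
  proof -
    interpret f: Vector_Spaces.linear s s f by fact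
    have 1: "f (Hilbert_Choice.inv f x) = x" for x
      using that(2) by (simp add: bij_is_surj surj_f_inv_f)
    have 2: "Hilbert_Choice.inv f (f x) = x" for x
      using that(2) by (simp add: bij_is_inj)
    show ?thesis
      by unfold_locales (metis 1 2 f.add, metis 1 2 f.scale)
  qed
  show ?thesis
  proof (rule groupI)
    fix f assume "f \<in> carrier (GL s)"
    then show "\<exists>g\<in>carrier (GL s). g \<otimes>\<^bsub>GL s\<^esub> f = \<one>\<^bsub>GL s\<^esub>"
      by (intro bexI[of _ "Hilbert_Choice.inv f"])
         (auto simp: GL_def inv bij_imp_bij_inv bij_is_inj)
  qed (auto simp: GL_def Vector_Spaces.linear_compose bij_comp linear_id comp_assoc)
qed

lemma comm_group_complex_units: "comm_group complex_units"
proof (rule comm_groupI)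
  fix x assume "x \<in> carrier complex_units"
  then show "\<exists>y\<in>carrier complex_units. y \<otimes>\<^bsub>complex_units\<^esub> x = \<one>\<^bsub>complex_units\<^esub>"
    by (intro bexI[of _ "inverse x"]) (auto simp: complex_units_def)
qed (auto simp: complex_units_def)

lemma subgroup_cocycles2:
  assumes "group H" "comm_group A"
  shows "subgroup (cocycles2 H A) (cochains2 H A)"
proof -
  interpret H: group H by fact
  interpret A: comm_group A by fact
  interpret C: group "cochains2 H A"
    unfolding cochains2_def by (rule product_group) (rule A.group_axioms)
  have val: "f (x, y) \<in> carrier A"
    if "f \<in> carrier (cochains2 H A)" "x \<in> carrier H" "y \<in> carrier H" for f x y
    using that by (auto simp: cochains2_def PiE_iff)
  show ?thesis
  proof (rule C.subgroupI)
    show "cocycles2 H A \<subseteq> carrier (cochains2 H A)"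
      by (auto simp: cocycles2_def)
    have "\<one>\<^bsub>cochains2 H A\<^esub> \<in> cocycles2 H A"
      using C.one_closed by (auto simp: cocycles2_def cochains2_def)
    then show "cocycles2 H A \<noteq> {}" by blast
  next
    fix f assume f: "f \<in> cocycles2 H A"
    have fC: "f \<in> carrier (cochains2 H A)" using f by (simp add: cocycles2_def)
    have inv_f: "inv\<^bsub>cochains2 H A\<^esub> f = (\<lambda>p\<in>carrier H \<times> carrier H. inv\<^bsub>A\<^esub> (f p))"
      using fC unfolding cochains2_def by (subst inv_product_group) (auto simp: A.group_axioms)
    have "inv\<^bsub>A\<^esub> (f (y, z)) \<otimes>\<^bsub>A\<^esub> inv\<^bsub>A\<^esub> (f (x, y \<otimes>\<^bsub>H\<^esub> z)) =
        inv\<^bsub>A\<^esub> (f (x \<otimes>\<^bsub>H\<^esub> y, z)) \<otimes>\<^bsub>A\<^esub> inv\<^bsub>A\<^esub> (f (x, y))"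
      if "x \<in> carrier H" "y \<in> carrier H" "z \<in> carrier H" for x y z
      using f that val[OF fC] by (simp add: cocycles2_def flip: A.inv_mult)
    then show "inv\<^bsub>cochains2 H A\<^esub> f \<in> cocycles2 H A"
      using C.inv_closed[OF fC] by (auto simp: cocycles2_def inv_f)
  next
    fix f g assume f: "f \<in> cocycles2 H A" and g: "g \<in> cocycles2 H A"
    have fC: "f \<in> carrier (cochains2 H A)" and gC: "g \<in> carrier (cochains2 H A)"
      using f g by (simp_all add: cocycles2_def)
    have fg: "f \<otimes>\<^bsub>cochains2 H A\<^esub> g = (\<lambda>p\<in>carrier H \<times> carrier H. f p \<otimes>\<^bsub>A\<^esub> g p)"
      by (simp add: cochains2_def)
    have swap: "(a \<otimes>\<^bsub>A\<^esub> b) \<otimes>\<^bsub>A\<^esub> (c \<otimes>\<^bsub>A\<^esub> d) = (a \<otimes>\<^bsub>A\<^esub> c) \<otimes>\<^bsub>A\<^esub> (b \<otimes>\<^bsub>A\<^esub> d)"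
      if "a \<in> carrier A" "b \<in> carrier A" "c \<in> carrier A" "d \<in> carrier A" for a b c d
      using that by (simp add: A.m_ac)
    have "(f (y, z) \<otimes>\<^bsub>A\<^esub> g (y, z)) \<otimes>\<^bsub>A\<^esub> (f (x, y \<otimes>\<^bsub>H\<^esub> z) \<otimes>\<^bsub>A\<^esub> g (x, y \<otimes>\<^bsub>H\<^esub> z)) =
        (f (x \<otimes>\<^bsub>H\<^esub> y, z) \<otimes>\<^bsub>A\<^esub> g (x \<otimes>\<^bsub>H\<^esub> y, z)) \<otimes>\<^bsub>A\<^esub> (f (x, y) \<otimes>\<^bsub>A\<^esub> g (x, y))"
      if xyz: "x \<in> carrier H" "y \<in> carrier H" "z \<in> carrier H" for x y z
    proof -
      have "f (y, z) \<otimes>\<^bsub>A\<^esub> f (x, y \<otimes>\<^bsub>H\<^esub> z) = f (x \<otimes>\<^bsub>H\<^esub> y, z) \<otimes>\<^bsub>A\<^esub> f (x, y)"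
        "g (y, z) \<otimes>\<^bsub>A\<^esub> g (x, y \<otimes>\<^bsub>H\<^esub> z) = g (x \<otimes>\<^bsub>H\<^esub> y, z) \<otimes>\<^bsub>A\<^esub> g (x, y)"
        using f g xyz unfolding cocycles2_def by blast+
      then show ?thesis
        using swap[of "f (y, z)" "g (y, z)" "f (x, y \<otimes>\<^bsub>H\<^esub> z)" "g (x, y \<otimes>\<^bsub>H\<^esub> z)"]
          swap[of "f (x \<otimes>\<^bsub>H\<^esub> y, z)" "g (x \<otimes>\<^bsub>H\<^esub> y, z)" "f (x, y)" "g (x, y)"]
          xyz val[OF fC] val[OF gC] H.m_closed
        by metis
    qed
    then show "f \<otimes>\<^bsub>cochains2 H A\<^esub> g \<in> cocycles2 H A"
      using C.m_closed[OF fC gC] by (auto simp: cocycles2_def fg)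
  qed
qed

lemma comm_group_cochains2:
  assumes "comm_group A"
  shows "comm_group (cochains2 H A)"
proof -
  interpret A: comm_group A by fact
  interpret C: group "cochains2 H A"
    unfolding cochains2_def by (rule product_group) (rule A.group_axioms)
  show ?thesis
    by (rule C.group_comm_groupI)
       (auto simp: cochains2_def PiE_iff A.m_comm intro!: restrict_ext)
qed

lemma comm_group_cocycles2:
  assumes "group H" "comm_group A"
  shows "comm_group ((cochains2 H A)\<lparr>carrier := cocycles2 H A\<rparr>)"
proof -
  interpret C: comm_group "cochains2 H A"
    by (rule comm_group_cochains2) (rule assms)
  note Z = subgroup_cocycles2[OF assms]
  show ?thesis
    by (rule group.group_comm_groupI[OF C.subgroup_imp_group[OF Z]])
       (auto intro: C.m_comm dest: subgroup.mem_carrier[OF Z])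
qed

lemma coboundaries2_normal:
  assumes "group H" "comm_group A"
  shows "coboundaries2 H A \<lhd> (cochains2 H A)\<lparr>carrier := cocycles2 H A\<rparr>"
proof -
  interpret H: group H by fact
  interpret A: comm_group A by fact
  interpret C: comm_group "cochains2 H A"
    by (rule comm_group_cochains2) (rule assms)
  note Z = subgroup_cocycles2[OF assms]
  have C1: "coboundary H A c \<in> carrier (cochains2 H A)" if "c \<in> carrier H \<rightarrow> carrier A" for c
    using that by (auto simp: coboundary_def cochains2_def Pi_iff)
  have cancel: "(a \<otimes>\<^bsub>A\<^esub> inv\<^bsub>A\<^esub> b \<otimes>\<^bsub>A\<^esub> d) \<otimes>\<^bsub>A\<^esub> (b \<otimes>\<^bsub>A\<^esub> e \<otimes>\<^bsub>A\<^esub> g) = a \<otimes>\<^bsub>A\<^esub> (e \<otimes>\<^bsub>A\<^esub> (d \<otimes>\<^bsub>A\<^esub> g))"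
    if "a \<in> carrier A" "b \<in> carrier A" "d \<in> carrier A" "e \<in> carrier A" "g \<in> carrier A" for a b d e g
  proof -
    have "inv\<^bsub>A\<^esub> b \<otimes>\<^bsub>A\<^esub> (b \<otimes>\<^bsub>A\<^esub> u) = u" if "u \<in> carrier A" for u
      using that \<open>b \<in> carrier A\<close> by (simp flip: A.m_assoc)
    moreover have "(a \<otimes>\<^bsub>A\<^esub> inv\<^bsub>A\<^esub> b \<otimes>\<^bsub>A\<^esub> d) \<otimes>\<^bsub>A\<^esub> (b \<otimes>\<^bsub>A\<^esub> e \<otimes>\<^bsub>A\<^esub> g) =
        a \<otimes>\<^bsub>A\<^esub> (inv\<^bsub>A\<^esub> b \<otimes>\<^bsub>A\<^esub> (b \<otimes>\<^bsub>A\<^esub> (e \<otimes>\<^bsub>A\<^esub> (d \<otimes>\<^bsub>A\<^esub> g))))"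
      using that by (simp add: A.m_ac)
    ultimately show ?thesis using that by simp
  qed
  have "coboundary H A c \<in> cocycles2 H A" if c: "c \<in> carrier H \<rightarrow> carrier A" for c
  proof -
    have c': "c x \<in> carrier A" if "x \<in> carrier H" for x using c that by blast
    have "coboundary H A c (y, z) \<otimes>\<^bsub>A\<^esub> coboundary H A c (x, y \<otimes>\<^bsub>H\<^esub> z) =
        coboundary H A c (x \<otimes>\<^bsub>H\<^esub> y, z) \<otimes>\<^bsub>A\<^esub> coboundary H A c (x, y)"
      if xyz: "x \<in> carrier H" "y \<in> carrier H" "z \<in> carrier H" for x y z
    proof -
      have "coboundary H A c (y, z) \<otimes>\<^bsub>A\<^esub> coboundary H A c (x, y \<otimes>\<^bsub>H\<^esub> z) =
          c z \<otimes>\<^bsub>A\<^esub> (inv\<^bsub>A\<^esub> c (x \<otimes>\<^bsub>H\<^esub> (y \<otimes>\<^bsub>H\<^esub> z)) \<otimes>\<^bsub>A\<^esub> (c y \<otimes>\<^bsub>A\<^esub> c x))"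
        using xyz by (simp add: coboundary_def cancel c')
      also have "\<dots> = (c y \<otimes>\<^bsub>A\<^esub> inv\<^bsub>A\<^esub> c (x \<otimes>\<^bsub>H\<^esub> y) \<otimes>\<^bsub>A\<^esub> c x) \<otimes>\<^bsub>A\<^esub>
          (c (x \<otimes>\<^bsub>H\<^esub> y) \<otimes>\<^bsub>A\<^esub> inv\<^bsub>A\<^esub> c (x \<otimes>\<^bsub>H\<^esub> (y \<otimes>\<^bsub>H\<^esub> z)) \<otimes>\<^bsub>A\<^esub> c z)"
        using xyz by (subst cancel) (simp_all add: c' A.m_ac)
      also have "\<dots> = coboundary H A c (x \<otimes>\<^bsub>H\<^esub> y, z) \<otimes>\<^bsub>A\<^esub> coboundary H A c (x, y)"
        using xyz by (simp add: coboundary_def c' H.m_assoc A.m_ac)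
      finally show ?thesis .
    qed
    then show ?thesis using C1[OF c] by (simp add: cocycles2_def)
  qed
  then have sub: "coboundaries2 H A \<subseteq> cocycles2 H A"
    by (auto simp: coboundaries2_def)
  have "subgroup (coboundaries2 H A) (cochains2 H A)"
  proof (rule C.subgroupI)
    show "coboundaries2 H A \<subseteq> carrier (cochains2 H A)"
      using C1 by (auto simp: coboundaries2_def)
    show "coboundaries2 H A \<noteq> {}"
      using A.one_closed by (auto simp: coboundaries2_def)
  next
    fix f assume "f \<in> coboundaries2 H A"
    then obtain c where c: "c \<in> carrier H \<rightarrow> carrier A" and f: "f = coboundary H A c"
      by (auto simp: coboundaries2_def)
    have "inv\<^bsub>cochains2 H A\<^esub> f = (\<lambda>p\<in>carrier H \<times> carrier H. inv\<^bsub>A\<^esub> (f p))"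
      using C1[OF c] unfolding cochains2_def f by (subst inv_product_group) (auto simp: A.group_axioms)
    also have "\<dots> = coboundary H A (\<lambda>x. inv\<^bsub>A\<^esub> c x)"
      using c unfolding f coboundary_def by (auto simp: A.inv_mult Pi_iff intro!: restrict_ext)
    finally show "inv\<^bsub>cochains2 H A\<^esub> f \<in> coboundaries2 H A"
      using c by (auto simp: coboundaries2_def)
  next
    fix f g assume "f \<in> coboundaries2 H A" "g \<in> coboundaries2 H A"
    then obtain c d where c: "c \<in> carrier H \<rightarrow> carrier A" "f = coboundary H A c"
      and d: "d \<in> carrier H \<rightarrow> carrier A" "g = coboundary H A d"
      by (auto simp: coboundaries2_def)
    have "f \<otimes>\<^bsub>cochains2 H A\<^esub> g = coboundary H A (\<lambda>x. c x \<otimes>\<^bsub>A\<^esub> d x)"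
      using c d unfolding coboundary_def
      by (auto simp: cochains2_def A.inv_mult Pi_iff A.m_ac intro!: restrict_ext)
    moreover have "(\<lambda>x. c x \<otimes>\<^bsub>A\<^esub> d x) \<in> carrier H \<rightarrow> carrier A" using c d by auto
    ultimately show "f \<otimes>\<^bsub>cochains2 H A\<^esub> g \<in> coboundaries2 H A"
      by (auto simp: coboundaries2_def)
  qed
  then have "subgroup (coboundaries2 H A) ((cochains2 H A)\<lparr>carrier := cocycles2 H A\<rparr>)"
    by (rule C.subgroup_incl[OF _ Z sub])
  moreover have "comm_group ((cochains2 H A)\<lparr>carrier := cocycles2 H A\<rparr>)"
    by (rule comm_group_cocycles2) (rule assms)+
  ultimately show ?thesis
    by (simp add: comm_group.normal_iff_subgroup)
qed

lemma comm_group_H2: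
  assumes "group H" "comm_group A"
  shows "comm_group (H2 H A)"
  unfolding H2_def
  by (rule comm_group.abelian_FactGroup[OF comm_group_cocycles2[OF assms]
        normal_imp_subgroup[OF coboundaries2_normal[OF assms]]])

end

theory Submission
  imports
    Defs
    "HOL-Algebra.Multiplicative_Group"
    "HOL-Computational_Algebra.Fundamental_Theorem_Algebra"
    "HOL-Analysis.Continuum_Not_Denumerable"
begin

text \<open>
  Write \<open>x \<triangleright> y\<close> for \<open>x \<otimes> y \<otimes> inv x\<close>.

  Multiplying a representation of \<open>G\<close> by a nowhere vanishing function \<open>\<chi>\<close> does not change the
  invariant subspaces, and the result is a quandle representation of \<open>Conj G\<close> if and only if \<open>\<chi>\<close> is
  a class function, that is, a character of \<open>Conj G\<close> (\<open>irreducible_action_rescale\<close>,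
  \<open>twist_quandle_rep_iff\<close>). So the point is to find, for an irreducible quandle representation \<open>\<rho>\<close>
  of \<open>Conj G\<close>, a representation \<open>\<rho>'\<close> of \<open>G\<close> such that each \<open>\<rho> g\<close> is a nonzero scalar
  multiple of \<open>\<rho>' g\<close>.

  Conjugation by \<open>\<rho> (x \<otimes> y)\<close> and by \<open>\<rho> x \<circ> \<rho> y\<close> agree on all \<open>\<rho> z\<close>, and \<open>\<rho> k\<close> commutes with all
  \<open>\<rho> z\<close> if \<open>k\<close> is central. By Schur's lemma \<open>\<rho>\<close> is a projective representation of \<open>G\<close> in
  which the centre acts by scalars (\<open>\<rho>_projective\<close>, \<open>\<rho>_central\<close>). The space is not known to be
  finite-dimensional, but it has countable dimension since \<open>G\<close> is finite, and this suffices for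
  Dixmier's version of Schur's lemma (\<open>schur_dixmier\<close>).

  Let \<open>\<theta> : G \<rightarrow> H\<close> be the Schur cover, \<open>K\<close> its kernel and \<open>\<sigma>\<close> a section of \<open>\<theta>\<close>. Since \<open>K\<close> is
  central, \<open>\<rho> \<circ> \<sigma>\<close> is a projective representation of \<open>H\<close>, with a 2-cocycle \<open>\<beta>\<close>. The
  transgression sends a character of \<open>K\<close> to its composition with the factor set of the extension. It
  is injective into \<open>H\<^sup>2(H, \<complex>\<^sup>\<times>)\<close> because \<open>K\<close> lies in the derived subgroup, and bijective by
  counting, as \<open>K\<close> has at least \<open>card K\<close> characters (\<open>finite_group_enough_characters\<close>) and
  \<open>H\<^sup>2(H, \<complex>\<^sup>\<times>)\<close> has \<open>card K\<close> elements. Hence \<open>\<beta>\<close> is cohomologous to the transgression of some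
  character \<open>\<chi>\<close> (\<open>cocycle_cohomologous_to_transgression\<close>), which is what is needed to correct
  \<open>\<rho> \<circ> \<sigma> \<circ> \<theta>\<close> by scalars to a representation of \<open>G\<close> (\<open>lift_hom\<close>).
\<close>

section \<open>Schur's lemma in countable dimension\<close>

context vector_space
begin

lemma countable_independent_in_span:
  assumes B: "independent B" "B \<subseteq> span C" and C: "countable C"
  shows "countable B"
proof -
  \<comment> \<open>The countable set \<open>C\<close> is the union of an increasing chain of finite sets \<open>D n\<close>, so \<open>B\<close> is
    the union of the sets \<open>B \<inter> span (D n)\<close>, each of which is finite.\<close>
  define D where "D n = {c \<in> C. to_nat_on C c < n}" for n
  have "inj_on (to_nat_on C) C"
    using C by (rule inj_on_to_nat_on)
  then have "finite (D n)" for n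
    by (rule_tac finite_imageD[of "to_nat_on C"])
       (auto simp: D_def inj_on_def intro: finite_subset[of _ "{..<n}"])
  then have fin: "finite (B \<inter> span (D n))" for n
    using independent_span_bound[of "D n" "B \<inter> span (D n)"] B(1)
    by (meson Int_lower1 Int_lower2 independent_mono)
  have "b \<in> (\<Union>n. B \<inter> span (D n))" if b: "b \<in> B" for b
  proof -
    obtain t r where t: "finite t" "t \<subseteq> C" "b = (\<Sum>a\<in>t. r a *s a)"
      using b B(2) unfolding span_explicit by blast
    have "t \<subseteq> D (Suc (Max (to_nat_on C ` t)))"
      using t by (auto simp: D_def less_Suc_eq_le)
    then have "b \<in> span (D (Suc (Max (to_nat_on C ` t))))"
      unfolding t(3) by (intro span_sum span_scale span_base) auto
    then show ?thesis using b by blast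
  qed
  then have "B \<subseteq> (\<Union>n. B \<inter> span (D n))" by blast
  moreover have "countable (\<Union>n. B \<inter> span (D n))"
    using fin countable_finite by (intro countable_UN countableI_type) blast
  ultimately show ?thesis by (rule countable_subset)
qed

end

locale linear_operator = vector_space s + T: Vector_Spaces.linear s s T
  for s :: "'a::field \<Rightarrow> 'b::ab_group_add \<Rightarrow> 'b" (infixr \<open>*s\<close> 75) and T :: "'b \<Rightarrow> 'b"
begin

text \<open>The operator \<open>p(T)\<close>, evaluated by Horner's scheme.\<close>

definition poly_op :: "'a poly \<Rightarrow> 'b \<Rightarrow> 'b" where
  "poly_op p = fold_coeffs (\<lambda>a f v. a *s v + T (f v)) p (\<lambda>_. 0)"

lemma poly_op_0: "poly_op 0 v = 0"
  by (simp add: poly_op_def)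

lemma poly_op_pCons: "poly_op (pCons a p) v = a *s v + T (poly_op p v)"
  by (cases "p = 0 \<and> a = 0") (auto simp: poly_op_def T.zero)

lemma poly_op_add_right: "poly_op p (v + w) = poly_op p v + poly_op p w"
  by (induction p) (simp_all add: poly_op_0 poly_op_pCons T.add scale_right_distrib)

lemma poly_op_scale_right: "poly_op p (c *s v) = c *s poly_op p v"
  by (induction p) (simp_all add: poly_op_0 poly_op_pCons T.scale scale_right_distrib mult.commute)

lemma poly_op_zero_right: "poly_op p 0 = 0"
  using poly_op_scale_right[of p 0 0] by simp

lemma poly_op_sum_right: "poly_op p (\<Sum>i\<in>I. f i) = (\<Sum>i\<in>I. poly_op p (f i))"
  by (induction I rule: infinite_finite_induct) (simp_all add: poly_op_zero_right poly_op_add_right)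

lemma poly_op_add: "poly_op (p + q) v = poly_op p v + poly_op q v"
proof (induction p arbitrary: q)
  case (pCons a p)
  obtain b r where q: "q = pCons b r" by (cases q)
  have "poly_op (pCons a p + q) v = (a + b) *s v + T (poly_op p v + poly_op r v)"
    by (simp add: q poly_op_pCons pCons.IH)
  then show ?case
    by (simp add: q poly_op_pCons T.add scale_left_distrib add_ac)
qed (simp add: poly_op_0)

lemma poly_op_smult: "poly_op (smult c p) v = c *s poly_op p v"
  by (induction p) (simp_all add: poly_op_0 poly_op_pCons T.scale scale_right_distrib)

lemma poly_op_sum: "poly_op (\<Sum>i\<in>I. f i) v = (\<Sum>i\<in>I. poly_op (f i) v)"
  by (induction I rule: infinite_finite_induct) (simp_all add: poly_op_0 poly_op_add)

lemma poly_op_mult: "poly_op (p * q) v = poly_op p (poly_op q v)"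
  by (induction p) (simp_all add: poly_op_0 poly_op_pCons poly_op_add poly_op_smult)

lemma poly_op_linear_factor: "poly_op [:- a, 1:] v = T v - a *s v"
  by (simp add: poly_op_0 poly_op_pCons T.zero)

end

locale complex_operator = linear_operator s T
  for s :: "complex \<Rightarrow> 'b::ab_group_add \<Rightarrow> 'b" (infixr \<open>*s\<close> 75) and T :: "'b \<Rightarrow> 'b"
begin

text \<open>
  If \<open>T\<close> has no eigenvector, then every nonzero polynomial in \<open>T\<close> is injective, because it is a
  nonzero scalar times a product of factors \<open>T - a\<close>.
\<close>

lemma poly_op_nonzero:
  assumes no_eigenvalue: "\<And>a w. T w = a *s w \<Longrightarrow> w = 0"
    and "p \<noteq> 0" "v \<noteq> 0"
  shows "poly_op p v \<noteq> 0"
  using \<open>p \<noteq> 0\<close>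
proof (induction "degree p" arbitrary: p)
  case 0
  then obtain c where "p = [:c:]" "c \<noteq> 0"
    by (metis degree_eq_zeroE pCons_0_0)
  then show ?case
    using \<open>v \<noteq> 0\<close> by (simp add: poly_op_pCons poly_op_0 T.zero)
next
  case (Suc n)
  then have "\<not> constant (poly p)"
    by (simp add: constant_degree)
  then obtain a where "poly p a = 0"
    using fundamental_theorem_of_algebra by blast
  then obtain q where p: "p = [:- a, 1:] * q"
    by (auto simp: poly_eq_0_iff_dvd)
  then have "q \<noteq> 0" using Suc.prems by auto
  then have "degree p = degree [:- a, 1:] + degree q"
    unfolding p by (intro degree_mult_eq) auto
  then have "poly_op q v \<noteq> 0"
    using Suc \<open>q \<noteq> 0\<close> by simp
  then show ?case
    using no_eigenvalue[of "poly_op q v" a]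
    unfolding p poly_op_mult poly_op_linear_factor by auto
qed

text \<open>
  Here \<open>u a\<close> is the image of \<open>v\<close> under the inverse of \<open>T - a\<close>. Applying the product of
  the operators \<open>T - a\<close> to a linear relation between the \<open>u a\<close> with coefficients \<open>r (u a)\<close>
  gives \<open>q(T) v = 0\<close> for a polynomial \<open>q\<close> whose value at each \<open>b\<close> is \<open>r (u b)\<close> times a
  nonzero number; but \<open>q = 0\<close> by the previous lemma.
\<close>

lemma resolvent_independent:
  assumes no_eigenvalue: "\<And>a w. T w = a *s w \<Longrightarrow> w = 0"
    and "v \<noteq> 0" and u: "\<And>a. T (u a) - a *s u a = v"
  shows "inj u" and "independent (range u)"
proof -
  show inj: "inj u"
  proof (rule injI, rule ccontr)
    fix a b assume eq: "u a = u b" and "a \<noteq> b"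
    have "T (u a) - a *s u a = T (u a) - b *s u a"
      using u[of a] u[of b] eq by simp
    then have "u a = 0" using \<open>a \<noteq> b\<close> by simp
    then show False using u[of a] \<open>v \<noteq> 0\<close> by (simp add: T.zero)
  qed
  have "r w = 0" if t: "finite t" "t \<subseteq> range u" and sum0: "(\<Sum>w\<in>t. r w *s w) = 0" and w: "w \<in> t" for t r w
  proof -
    obtain F where F: "t = u ` F" using t(2) by (metis subset_imageE)
    have finF: "finite F"
      using t(1) inj unfolding F by (metis finite_imageD inj_on_subset subset_UNIV)
    obtain b where b: "b \<in> F" "w = u b" using w F by blast
    define P where "P a = (\<Prod>c\<in>F - {a}. [:- c, 1:])" for a
    define q where "q = (\<Sum>a\<in>F. smult (r (u a)) (P a))"
    have "poly_op (P a) v = poly_op (\<Prod>c\<in>F. [:- c, 1:]) (u a)" if "a \<in> F" for a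
    proof -
      have "(\<Prod>c\<in>F. [:- c, 1:]) = P a * [:- a, 1:]"
        unfolding P_def using finF that by (subst prod.remove[of F a]) (simp_all only: mult.commute)
      then show ?thesis by (simp only: poly_op_mult poly_op_linear_factor u)
    qed
    then have "poly_op q v = poly_op (\<Prod>c\<in>F. [:- c, 1:]) (\<Sum>a\<in>F. r (u a) *s u a)"
      unfolding q_def by (simp add: poly_op_sum poly_op_smult poly_op_sum_right poly_op_scale_right)
    also have "(\<Sum>a\<in>F. r (u a) *s u a) = 0"
      using sum0 unfolding F by (subst (asm) sum.reindex) (auto intro: inj_on_subset[OF inj])
    finally have "poly_op q v = 0" by (simp only: poly_op_zero_right)
    then have "q = 0"
      using poly_op_nonzero no_eigenvalue \<open>v \<noteq> 0\<close> by blast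
    have "poly (P a) b = 0" if "a \<in> F - {b}" for a
      using that b finF by (auto simp: P_def poly_prod)
    then have "poly q b = r (u b) * poly (P b) b"
      using finF b by (simp add: q_def poly_sum sum.remove[of F b])
    moreover have "poly (P b) b \<noteq> 0"
      using finF by (simp add: P_def poly_prod)
    ultimately show "r w = 0" using \<open>q = 0\<close> b by simp
  qed
  then show "independent (range u)"
    unfolding independent_explicit_module by blast
qed

end

text \<open>
  Schur's lemma for spaces of countable dimension. The dimension is countable because \<open>V\<close> is spanned
  by the images of a single vector under words in \<open>X\<close>. If \<open>T\<close> were not a scalar, then by
  irreducibility every \<open>T - a\<close> would have zero kernel and full range, and the resolvent vectors
  \<open>u a\<close> would form an uncountable independent set.
\<close>

lemma schur_dixmier:
  fixes s :: "complex \<Rightarrow> 'v::ab_group_add \<Rightarrow> 'v"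
  assumes vs: "vector_space s"
    and irr: "irreducible_action s X \<rho>" and X: "countable X"
    and lin: "\<And>x. x \<in> X \<Longrightarrow> Vector_Spaces.linear s s (\<rho> x)"
    and T: "Vector_Spaces.linear s s T"
    and comm: "\<And>x v. x \<in> X \<Longrightarrow> T (\<rho> x v) = \<rho> x (T v)"
  obtains c where "T = s c"
proof -
  interpret vector_space s by fact
  interpret complex_operator s T
    using vs T by (simp add: complex_operator_def linear_operator_def)
  have lin': "module_hom s s (\<rho> x)" if "x \<in> X" for x
    using lin[OF that] by (simp add: Vector_Spaces.linear_def)
  have dichotomy: "W = {0} \<or> W = UNIV" if "subspace W" "\<And>x w. x \<in> X \<Longrightarrow> w \<in> W \<Longrightarrow> \<rho> x w \<in> W" for W
    using irr that unfolding irreducible_action_def invariant_subspace_def by blast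
  obtain v :: 'v where "v \<noteq> 0"
    using irr by (auto simp: irreducible_action_def)
  define C where "C = (\<lambda>xs. foldr \<rho> xs v) ` lists X"
  have "countable C" unfolding C_def using X by simp
  have "span C = {0} \<or> span C = UNIV"
  proof (rule dichotomy)
    fix x w assume x: "x \<in> X" and w: "w \<in> span C"
    interpret R: module_hom s s "\<rho> x" by (rule lin'[OF x])
    have "\<rho> x ` C \<subseteq> C"
    proof
      fix w assume "w \<in> \<rho> x ` C"
      then obtain xs where "xs \<in> lists X" "w = foldr \<rho> (x # xs) v"
        by (auto simp: C_def)
      then show "w \<in> C"
        unfolding C_def using x by (intro image_eqI[of _ _ "x # xs"]) auto
    qed
    then have "span (\<rho> x ` C) \<subseteq> span C" by (rule span_mono)
    then show "\<rho> x w \<in> span C" using w R.span_image[of C] by blast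
  qed simp
  moreover have "v \<in> C" unfolding C_def by (intro image_eqI[of _ _ "[]"]) auto
  ultimately have C: "span C = UNIV"
    using \<open>v \<noteq> 0\<close> span_base[of v C] by auto
  have "\<exists>c. \<forall>w. T w = s c w"
  proof (rule ccontr)
    assume contra: "\<nexists>c. \<forall>w. T w = s c w"
    have no_eigenvalue: "w = 0" if "T w = s a w" for a w
    proof -
      have "{w. T w = s a w} = {0} \<or> {w. T w = s a w} = UNIV"
      proof (rule dichotomy)
        show "subspace {w. T w = s a w}"
          by (rule subspaceI)
            (auto simp: T.zero T.add T.scale scale_right_distrib mult.commute)
        show "\<rho> x w \<in> {w. T w = s a w}" if "x \<in> X" "w \<in> {w. T w = s a w}" for x w
          using that comm module_hom.scale[OF lin'] by simp
      qed
      then show ?thesis using contra that by blast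
    qed
    have "\<exists>w. T w - s a w = v" for a
    proof -
      have "range (\<lambda>w. T w - s a w) = {0} \<or> range (\<lambda>w. T w - s a w) = UNIV"
      proof (rule dichotomy)
        interpret N: module_hom s s "\<lambda>w. T w - s a w"
          by unfold_locales (simp_all add: T.add T.scale algebra_simps)
        show "subspace (range (\<lambda>w. T w - s a w))"
          by (rule N.subspace_image) simp
        show "\<rho> x w \<in> range (\<lambda>w. T w - s a w)" if x: "x \<in> X" and w: "w \<in> range (\<lambda>w. T w - s a w)" for x w
        proof -
          obtain w' where "w = T w' - s a w'" using w by blast
          then have "\<rho> x w = T (\<rho> x w') - s a (\<rho> x w')"
            using x comm module_hom.scale[OF lin'] module_hom.diff[OF lin'] by simp
          then show ?thesis by blast
        qed
      qed
      then show ?thesis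
      proof
        assume "range (\<lambda>w. T w - s a w) = {0}"
        then have "T w - s a w = 0" for w by blast
        then have "\<forall>w. T w = s a w" by simp
        then show ?thesis using contra by blast
      next
        assume "range (\<lambda>w. T w - s a w) = UNIV"
        then have "v \<in> range (\<lambda>w. T w - s a w)" by simp
        then show ?thesis by blast
      qed
    qed
    then have "\<exists>u. \<forall>a. T (u a) - s a (u a) = v" by (intro choice allI)
    then obtain u where u: "\<And>a. T (u a) - s a (u a) = v" by blast
    have "inj u"
      by (rule resolvent_independent(1)[OF no_eigenvalue \<open>v \<noteq> 0\<close> u])
    have "independent (range u)"
      by (rule resolvent_independent(2)[OF no_eigenvalue \<open>v \<noteq> 0\<close> u])
    have "countable (range u)"
      by (rule countable_independent_in_span[OF \<open>independent (range u)\<close> _ \<open>countable C\<close>]) (simp add: C)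
    then have "countable (UNIV :: complex set)"
      using \<open>inj u\<close> by (metis countable_image_inj_on)
    then show False using uncountable_UNIV_complex by blast
  qed
  then show ?thesis using that by (auto simp: fun_eq_iff)
qed


section \<open>Characters of finite abelian groups\<close>

text \<open>
  The characters \<open>M \<rightarrow> \<complex>\<^sup>\<times>\<close> of a subgroup \<open>M\<close> of \<open>G\<close>, represented by functions that are
  \<open>undefined\<close> outside \<open>M\<close> so that they can be counted.
\<close>

definition characters_on :: "('a, 'm) monoid_scheme \<Rightarrow> 'a set \<Rightarrow> ('a \<Rightarrow> complex) set" where
  "characters_on G M = hom (G\<lparr>carrier := M\<rparr>) complex_units \<inter> extensional M"

lemma characters_on_iff:
  "\<chi> \<in> characters_on G M \<longleftrightarrow>
    (\<forall>x\<in>M. \<chi> x \<noteq> 0) \<and> (\<forall>x\<in>M. \<forall>y\<in>M. \<chi> (x \<otimes>\<^bsub>G\<^esub> y) = \<chi> x * \<chi> y) \<and> \<chi> \<in> extensional M"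
  by (auto simp: characters_on_def hom_def complex_units_def)

lemma (in group) characters_on_one:
  assumes "subgroup M G" "\<chi> \<in> characters_on G M"
  shows "\<chi> \<one> = 1"
proof -
  have "\<one> \<in> M" using assms(1) by (rule subgroup.one_closed)
  then have "\<chi> (\<one> \<otimes> \<one>) = \<chi> \<one> * \<chi> \<one>" "\<chi> \<one> \<noteq> 0"
    using assms(2) unfolding characters_on_iff by blast+
  then show ?thesis by simp
qed

lemma (in group) characters_on_pow:
  assumes "subgroup M G" "\<chi> \<in> characters_on G M" "x \<in> M"
  shows "\<chi> (x [^] (k::nat)) = \<chi> x ^ k"
proof (induction k)
  case (Suc k)
  have "x [^] k \<in> M"
    using subgroup_int_pow_closed[OF assms(1,3), of "int k"] by (simp add: int_pow_int)
  then show ?case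
    using Suc assms by (simp add: characters_on_iff)
qed (simp add: characters_on_one[OF assms(1,2)])

context comm_group
begin

text \<open>
  Let \<open>n\<close> be the order of \<open>g\<close> modulo \<open>M\<close>. Each character \<open>\<chi>\<close> of \<open>M\<close> extends to the subgroup
  generated by \<open>M\<close> and \<open>g\<close> by sending \<open>g\<close> to any of the \<open>n\<close> complex \<open>n\<close>-th roots of
  \<open>\<chi> (g [^] n)\<close>, while the order of the subgroup grows by at most the factor \<open>n\<close>.
\<close>

lemma characters_on_extend:
  assumes fin: "finite (carrier G)" and M: "subgroup M G" and g: "g \<in> carrier G" "g \<notin> M"
    and X: "finite X" "card M \<le> card X" "X \<subseteq> characters_on G M"
  obtains M' X' where "subgroup M' G" "M \<subset> M'"
    "finite X'" "card M' \<le> card X'" "X' \<subseteq> characters_on G M'"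
proof -
  have MG: "m \<in> carrier G" if "m \<in> M" for m
    using subgroup.mem_carrier[OF M that] .
  note [simp] = g(1) MG subgroup.one_closed[OF M] subgroup.m_closed[OF M] subgroup.m_inv_closed[OF M]
  have powM: "m [^] (k::nat) \<in> M" if "m \<in> M" for m k
    using subgroup_int_pow_closed[OF M that, of "int k"] by (simp add: int_pow_int)
  define n where "n = (LEAST n::nat. 0 < n \<and> g [^] n \<in> M)"
  have "0 < Coset.order G \<and> g [^] Coset.order G \<in> M"
    using pow_order_eq_1[OF g(1)] fin by (simp add: order_gt_0_iff_finite)
  then have n: "0 < n \<and> g [^] n \<in> M"
    unfolding n_def by (rule LeastI)
  have split: "g [^] k = (g [^] n) [^] (k div n) \<otimes> g [^] (k mod n)" for k
    by (simp add: nat_pow_pow nat_pow_mult)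
  have dvd: "n dvd k" if k: "g [^] k \<in> M" for k
  proof (rule ccontr)
    assume "\<not> n dvd k"
    then have "0 < k mod n" by (simp add: mod_greater_zero_iff_not_dvd)
    have "g [^] (k mod n) = inv ((g [^] n) [^] (k div n)) \<otimes> g [^] k"
      unfolding split[of k] by (simp flip: m_assoc)
    then have "g [^] (k mod n) \<in> M"
      using k powM n by simp
    then have "n \<le> k mod n"
      using \<open>0 < k mod n\<close> unfolding n_def by (intro Least_le conjI)
    then show False using n by (metis mod_less_divisor not_le)
  qed
  define M' where "M' = M <#> generate G {g}"
  have M'_iff: "x \<in> M' \<longleftrightarrow> (\<exists>m\<in>M. \<exists>k::nat. x = m \<otimes> g [^] k)" for x
    unfolding M'_def set_mult_def generate_pow_on_finite_carrier[OF fin g(1)] by auto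
  have M': "subgroup M' G"
    unfolding M'_def by (intro mult_subgroups M generate_is_subgroup) simp
  have "M \<subseteq> M'"
    unfolding M'_iff subset_eq by (metis MG nat_pow_0 r_one)
  have "g \<in> M'"
    unfolding M'_iff by (rule bexI[of _ \<one>], rule exI[of _ 1]) simp_all
  have M'_sub: "M' \<subseteq> (\<lambda>(m, i). m \<otimes> g [^] i) ` (M \<times> {..<n})"
  proof
    fix x assume "x \<in> M'"
    then obtain m k where m: "m \<in> M" and x: "x = m \<otimes> g [^] (k::nat)" unfolding M'_iff by blast
    have "x = (m \<otimes> (g [^] n) [^] (k div n)) \<otimes> g [^] (k mod n)"
      unfolding x split[of k] using m by (simp add: m_assoc)
    then show "x \<in> (\<lambda>(m, i). m \<otimes> g [^] i) ` (M \<times> {..<n})"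
      using m n powM by (intro image_eqI[of _ _ "(m \<otimes> (g [^] n) [^] (k div n), k mod n)"]) auto
  qed
  have finM: "finite M" using fin MG by (meson finite_subset subsetI)
  have "card M' \<le> card (M \<times> {..<n})"
    using finM by (intro order_trans[OF card_mono[OF _ M'_sub] card_image_le]) auto
  then have cardM': "card M' \<le> card M * n" by (simp add: card_cartesian_product)

  \<comment> \<open>The extension of \<open>\<chi>\<close> with value \<open>z\<close> at \<open>g\<close>: it maps \<open>m \<otimes> g [^] k\<close> to \<open>\<chi> m * z ^ k\<close>, which
    \<open>wd\<close> shows to be independent of the choice of \<open>m\<close> and \<open>k\<close>.\<close>
  define ext where "ext = (\<lambda>(\<chi> :: 'a \<Rightarrow> complex, z). \<lambda>x\<in>M'.
    SOME y. \<exists>m\<in>M. \<exists>k::nat. x = m \<otimes> g [^] k \<and> y = \<chi> m * z ^ k)"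
  define P where "P = Sigma X (\<lambda>\<chi>. {z. z ^ n = \<chi> (g [^] n)})"
  have wd: "\<chi> m * z ^ j = \<chi> m' * z ^ k"
    if \<chi>: "\<chi> \<in> characters_on G M" and z: "z ^ n = \<chi> (g [^] n)" and m: "m \<in> M" "m' \<in> M"
      and eq: "m \<otimes> g [^] j = m' \<otimes> g [^] k" and "j \<le> k" for \<chi> z m m' and j k :: nat
  proof -
    have "m \<otimes> g [^] j = (m' \<otimes> g [^] (k - j)) \<otimes> g [^] j"
      using eq m \<open>j \<le> k\<close> by (simp add: m_assoc nat_pow_mult)
    then have m_eq: "m = m' \<otimes> g [^] (k - j)"
      using m by simp
    then have "g [^] (k - j) = inv m' \<otimes> m"
      using m by (simp flip: m_assoc)
    then have "g [^] (k - j) \<in> M" using m by simp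
    then obtain q where q: "k - j = n * q" using dvd by blast
    then have "g [^] (k - j) = (g [^] n) [^] q" by (simp add: nat_pow_pow)
    then have "\<chi> m = \<chi> m' * (z ^ n) ^ q"
      using m m_eq n \<chi> powM characters_on_pow[OF M \<chi>] z by (simp add: characters_on_iff)
    then have "\<chi> m = \<chi> m' * z ^ (k - j)" unfolding q by (simp add: power_mult)
    then show ?thesis using \<open>j \<le> k\<close> by (simp flip: power_add)
  qed
  have ext_eq: "ext (\<chi>, z) (m \<otimes> g [^] k) = \<chi> m * z ^ k"
    if "(\<chi>, z) \<in> P" "m \<in> M" for \<chi> z m and k :: nat
  proof -
    have \<chi>: "\<chi> \<in> characters_on G M" and z: "z ^ n = \<chi> (g [^] n)"
      using that(1) X(3) by (auto simp: P_def)
    have "m \<otimes> g [^] k \<in> M'" using that(2) M'_iff by blast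
    moreover have "(SOME y. \<exists>m'\<in>M. \<exists>k'::nat. m \<otimes> g [^] k = m' \<otimes> g [^] k' \<and> y = \<chi> m' * z ^ k') = \<chi> m * z ^ k"
    proof (rule some_equality)
      fix y assume "\<exists>m'\<in>M. \<exists>k'::nat. m \<otimes> g [^] k = m' \<otimes> g [^] k' \<and> y = \<chi> m' * z ^ k'"
      then obtain m' k' where "m' \<in> M" "m \<otimes> g [^] k = m' \<otimes> g [^] (k'::nat)" "y = \<chi> m' * z ^ k'" by blast
      then show "y = \<chi> m * z ^ k"
        using wd[OF \<chi> z that(2), of m' k k'] wd[OF \<chi> z _ that(2), of m' k' k]
        by (metis nat_le_linear)
    qed (use that(2) in blast)
    ultimately show ?thesis by (simp add: ext_def)
  qed
  have ext_M: "ext (\<chi>, z) m = \<chi> m" if "(\<chi>, z) \<in> P" "m \<in> M" for \<chi> z m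
    using ext_eq[OF that, of 0] that(2) by simp
  have "ext ` P \<subseteq> characters_on G M'"
  proof
    fix \<psi> assume "\<psi> \<in> ext ` P"
    then obtain \<chi> z where P: "(\<chi>, z) \<in> P" and \<psi>: "\<psi> = ext (\<chi>, z)" by auto
    have \<chi>: "\<chi> \<in> characters_on G M" and z: "z ^ n = \<chi> (g [^] n)"
      using P X(3) by (auto simp: P_def)
    have "\<chi> (g [^] n) \<noteq> 0" using n \<chi> by (simp add: characters_on_iff)
    then have "z \<noteq> 0" using z n by (metis power_eq_0_iff)
    have "\<psi> x \<noteq> 0" if "x \<in> M'" for x
      using that \<chi> \<open>z \<noteq> 0\<close> unfolding M'_iff \<psi> by (auto simp: ext_eq[OF P] characters_on_iff)
    moreover have "\<psi> (x \<otimes> y) = \<psi> x * \<psi> y" if xy: "x \<in> M'" "y \<in> M'" for x y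
    proof -
      obtain m j m' k where m: "m \<in> M" "m' \<in> M" and x: "x = m \<otimes> g [^] (j::nat)" and y: "y = m' \<otimes> g [^] (k::nat)"
        using xy unfolding M'_iff by blast
      have "x \<otimes> y = (m \<otimes> m') \<otimes> g [^] (j + k)"
        unfolding x y nat_pow_mult[OF g(1), symmetric] using m by (simp add: m_ac)
      then have "\<psi> (x \<otimes> y) = \<chi> (m \<otimes> m') * z ^ (j + k)"
        using ext_eq[OF P, of "m \<otimes> m'" "j + k"] m by (simp add: \<psi>)
      then show ?thesis
        using m \<chi> by (simp add: \<psi> x y ext_eq[OF P] characters_on_iff power_add)
    qed
    moreover have "\<psi> \<in> extensional M'" by (simp add: \<psi> ext_def)
    ultimately show "\<psi> \<in> characters_on G M'" unfolding characters_on_iff by blast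
  qed
  moreover have "inj_on ext P"
  proof (rule inj_onI, clarify)
    fix \<chi> z \<chi>' z' assume P: "(\<chi>, z) \<in> P" "(\<chi>', z') \<in> P" and eq: "ext (\<chi>, z) = ext (\<chi>', z')"
    then have \<chi>: "\<chi> \<in> characters_on G M" "\<chi>' \<in> characters_on G M"
      using X(3) by (auto simp: P_def)
    have "\<chi> = \<chi>'"
    proof (rule extensionalityI)
      show "\<chi> \<in> extensional M" "\<chi>' \<in> extensional M" using \<chi> by (auto simp: characters_on_iff)
      show "\<chi> x = \<chi>' x" if "x \<in> M" for x
        using ext_M[OF P(1) that] ext_M[OF P(2) that] eq by simp
    qed
    moreover have "z = z'"
      using ext_eq[OF P(1), of \<one> 1] ext_eq[OF P(2), of \<one> 1] eq
        characters_on_one[OF M \<chi>(1)] characters_on_one[OF M \<chi>(2)] by simp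
    ultimately show "\<chi> = \<chi>' \<and> z = z'" by blast
  qed
  moreover have "finite P" "card P = card X * n"
  proof -
    have "\<chi> (g [^] n) \<noteq> 0" if "\<chi> \<in> X" for \<chi>
      using that X(3) n by (auto simp: characters_on_iff)
    then have card_roots: "card {z. z ^ n = \<chi> (g [^] n)} = n" if "\<chi> \<in> X" for \<chi>
      using that n by (simp add: card_nth_roots)
    then have "finite {z. z ^ n = \<chi> (g [^] n)}" if "\<chi> \<in> X" for \<chi>
      using that n by (metis card.infinite less_numeral_extra(3))
    then show "finite P" "card P = card X * n"
      using X(1) card_roots by (auto simp: P_def card_SigmaI)
  qed
  ultimately have "finite (ext ` P)" "card M' \<le> card (ext ` P)" "ext ` P \<subseteq> characters_on G M'"
    using order_trans[OF cardM' mult_le_mono1[OF X(2), of n]] by (auto simp: card_image)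
  then show ?thesis
    using M' \<open>M \<subseteq> M'\<close> \<open>g \<in> M'\<close> g(2) by (intro that[of M' "ext ` P"]) auto
qed

text \<open>
  Among the subgroups \<open>M\<close> with at least \<open>card M\<close> characters, one of maximal order must be the
  whole group, since otherwise it could be enlarged.
\<close>

lemma finite_group_enough_characters:
  assumes fin: "finite (carrier G)"
  obtains X where "finite X" "card (carrier G) \<le> card X" "X \<subseteq> characters_on G (carrier G)"
proof -
  define P where "P M \<longleftrightarrow> subgroup M G \<and> (\<exists>X. finite X \<and> card M \<le> card X \<and> X \<subseteq> characters_on G M)" for M
  have "P {\<one>}"
    unfolding P_def
  proof (intro conjI exI)
    show "subgroup {\<one>} G" by (rule triv_subgroup)
    show "{\<lambda>x\<in>{\<one>}. 1} \<subseteq> characters_on G {\<one>}"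
      by (auto simp: characters_on_iff)
  qed auto
  moreover have "card M < Suc (card (carrier G))" if "P M" for M
    using that card_mono[OF fin] subgroup.subset by (auto simp: P_def less_Suc_eq_le)
  ultimately obtain M where M: "P M" and max: "\<And>M'. P M' \<Longrightarrow> card M' \<le> card M"
    using ex_has_greatest_nat[of P "{\<one>}" card] by metis
  have "M = carrier G"
  proof (rule ccontr)
    assume "M \<noteq> carrier G"
    moreover have "M \<subseteq> carrier G" using M subgroup.subset by (auto simp: P_def)
    ultimately obtain g where "g \<in> carrier G" "g \<notin> M" by blast
    then obtain M' where M': "P M'" "M \<subset> M'"
      using M characters_on_extend[OF fin] unfolding P_def by metis
    moreover have "finite M'"
      using M' fin subgroup.subset finite_subset unfolding P_def by metis
    ultimately show False
      using max[of M'] psubset_card_mono[of M' M] by simp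
  qed
  then show ?thesis using M that unfolding P_def by blast
qed

end


section \<open>Central extensions and the transgression\<close>

lemma inv_complex_units: "z \<noteq> 0 \<Longrightarrow> inv\<^bsub>complex_units\<^esub> z = inverse z"
proof -
  interpret comm_group complex_units by (rule comm_group_complex_units)
  show "z \<noteq> 0 \<Longrightarrow> ?thesis"
    by (intro inv_equality) (auto simp: complex_units_def)
qed

lemma (in group) hom_complex_units_derived:
  assumes f: "f \<in> hom G complex_units" and x: "x \<in> derived G (carrier G)"
  shows "f x = 1"
proof -
  interpret C: comm_group complex_units by (rule comm_group_complex_units)
  interpret f: group_hom G complex_units f by unfold_locales (rule f)
  have f_mult: "f (a \<otimes> b) = f a * f b" if "a \<in> carrier G" "b \<in> carrier G" for a b
    using f.hom_mult[OF that] by (simp add: complex_units_def)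
  have f_inv: "f (inv a) * f a = 1" if "a \<in> carrier G" for a
    using that f_mult[of "inv a" a] f.hom_one by (simp add: complex_units_def)
  have f_comm: "f (a \<otimes> b \<otimes> inv a \<otimes> inv b) = 1" if "a \<in> carrier G" "b \<in> carrier G" for a b
  proof -
    have "f (a \<otimes> b \<otimes> inv a \<otimes> inv b) = (f (inv a) * f a) * (f (inv b) * f b)"
      using that by (simp add: f_mult mult_ac del: f.hom_mult f.hom_inv)
    then show ?thesis using that by (simp add: f_inv del: f.hom_inv)
  qed
  have "derived_set G (carrier G) \<subseteq> kernel G complex_units f"
    using f_comm by (auto simp: kernel_def complex_units_def)
  then have "derived G (carrier G) \<subseteq> kernel G complex_units f"
    unfolding derived_def by (rule generate_subgroup_incl[OF _ f.subgroup_kernel])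
  then show ?thesis using x by (auto simp: kernel_def complex_units_def)
qed

text \<open>
  A surjective homomorphism \<open>\<theta> : G \<rightarrow> H\<close> with central kernel \<open>K\<close> and a set-theoretic section \<open>\<sigma>\<close>.
  The section is not required to satisfy \<open>\<sigma> \<one> = \<one>\<close>.
\<close>

locale central_extension = G: group G + H: group H
  for G :: "('g, 'm) monoid_scheme" (structure) and H :: "('h, 'n) monoid_scheme" +
  fixes \<theta> :: "'g \<Rightarrow> 'h" and \<sigma> :: "'h \<Rightarrow> 'g"
  assumes \<theta>_hom: "\<theta> \<in> hom G H"
    and kernel_central: "kernel G H \<theta> \<subseteq> group_center G"
    and \<sigma>_closed [simp]: "h \<in> carrier H \<Longrightarrow> \<sigma> h \<in> carrier G"
    and \<theta>_\<sigma> [simp]: "h \<in> carrier H \<Longrightarrow> \<theta> (\<sigma> h) = h"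
begin

sublocale \<theta>: group_hom G H \<theta>
  by unfold_locales (rule \<theta>_hom)

abbreviation "K \<equiv> kernel G H \<theta>"

text \<open>The \<open>K\<close>-component of \<open>g\<close> in the decomposition \<open>g = \<kappa> g \<otimes> \<sigma> (\<theta> g)\<close>.\<close>

definition \<kappa> :: "'g \<Rightarrow> 'g" where
  "\<kappa> g = g \<otimes> inv \<sigma> (\<theta> g)"

text \<open>The 2-cocycle of \<open>H\<close> with values in \<open>K\<close> that describes the extension.\<close>

definition factor_set :: "'h \<Rightarrow> 'h \<Rightarrow> 'g" where
  "factor_set x y = \<sigma> x \<otimes> \<sigma> y \<otimes> inv \<sigma> (x \<otimes>\<^bsub>H\<^esub> y)"

lemma subgroup_K: "subgroup K G"
  by (rule \<theta>.subgroup_kernel)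

lemma K_carrier: "k \<in> K \<Longrightarrow> k \<in> carrier G"
  by (simp add: kernel_def)

lemma \<theta>_K: "k \<in> K \<Longrightarrow> \<theta> k = \<one>\<^bsub>H\<^esub>"
  by (simp add: kernel_def)

lemma K_mult [simp]: "a \<in> K \<Longrightarrow> b \<in> K \<Longrightarrow> a \<otimes> b \<in> K"
  using subgroup.m_closed[OF subgroup_K] .

lemma K_commutes: "k \<in> K \<Longrightarrow> g \<in> carrier G \<Longrightarrow> k \<otimes> g = g \<otimes> k"
  using kernel_central by (auto simp: group_center_def)

lemma \<kappa>_in_K [simp]: "g \<in> carrier G \<Longrightarrow> \<kappa> g \<in> K"
  by (simp add: \<kappa>_def kernel_def)

lemma factor_set_in_K [simp]: "x \<in> carrier H \<Longrightarrow> y \<in> carrier H \<Longrightarrow> factor_set x y \<in> K"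
  by (simp add: factor_set_def kernel_def)

(* Declared only now: together with kernel_def this rule makes the simplifier loop. *)
declare K_carrier [simp]

lemma \<kappa>_K: "a \<in> K \<Longrightarrow> \<kappa> a = a \<otimes> \<kappa> \<one>"
  by (simp add: \<kappa>_def \<theta>_K)

lemma \<kappa>_decomp: "g \<in> carrier G \<Longrightarrow> \<kappa> g \<otimes> \<sigma> (\<theta> g) = g"
  by (simp add: \<kappa>_def G.m_assoc)

lemma \<sigma>_mult: "x \<in> carrier H \<Longrightarrow> y \<in> carrier H \<Longrightarrow> \<sigma> x \<otimes> \<sigma> y = factor_set x y \<otimes> \<sigma> (x \<otimes>\<^bsub>H\<^esub> y)"
  by (simp add: factor_set_def G.m_assoc)

lemma \<kappa>_mult:
  assumes "g \<in> carrier G" "g' \<in> carrier G"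
  shows "\<kappa> (g \<otimes> g') = \<kappa> g \<otimes> \<kappa> g' \<otimes> factor_set (\<theta> g) (\<theta> g')"
proof -
  have "g \<otimes> g' = (\<kappa> g \<otimes> \<sigma> (\<theta> g)) \<otimes> (\<kappa> g' \<otimes> \<sigma> (\<theta> g'))"
    using assms by (simp add: \<kappa>_decomp)
  also have "\<dots> = \<kappa> g \<otimes> (\<sigma> (\<theta> g) \<otimes> \<kappa> g') \<otimes> \<sigma> (\<theta> g')"
    using assms by (simp add: G.m_assoc)
  also have "\<sigma> (\<theta> g) \<otimes> \<kappa> g' = \<kappa> g' \<otimes> \<sigma> (\<theta> g)"
    using assms by (simp add: K_commutes)
  also have "\<kappa> g \<otimes> (\<kappa> g' \<otimes> \<sigma> (\<theta> g)) \<otimes> \<sigma> (\<theta> g') = \<kappa> g \<otimes> \<kappa> g' \<otimes> (\<sigma> (\<theta> g) \<otimes> \<sigma> (\<theta> g'))"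
    using assms by (simp add: G.m_assoc)
  also have "\<dots> = \<kappa> g \<otimes> \<kappa> g' \<otimes> factor_set (\<theta> g) (\<theta> g') \<otimes> \<sigma> (\<theta> (g \<otimes> g'))"
    using assms by (simp add: \<sigma>_mult G.m_assoc)
  finally have "\<kappa> (g \<otimes> g') \<otimes> \<sigma> (\<theta> (g \<otimes> g'))
      = \<kappa> g \<otimes> \<kappa> g' \<otimes> factor_set (\<theta> g) (\<theta> g') \<otimes> \<sigma> (\<theta> (g \<otimes> g'))"
    using \<kappa>_decomp[of "g \<otimes> g'"] assms by (simp only: G.m_closed)
  then show ?thesis
    using assms by (subst (asm) G.right_cancel) simp_all
qed

lemma factor_set_cocycle:
  assumes "x \<in> carrier H" "y \<in> carrier H" "z \<in> carrier H"
  shows "factor_set y z \<otimes> factor_set x (y \<otimes>\<^bsub>H\<^esub> z) = factor_set (x \<otimes>\<^bsub>H\<^esub> y) z \<otimes> factor_set x y"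
proof -
  have "factor_set y z \<otimes> factor_set x (y \<otimes>\<^bsub>H\<^esub> z) \<otimes> \<sigma> (x \<otimes>\<^bsub>H\<^esub> (y \<otimes>\<^bsub>H\<^esub> z))
      = factor_set y z \<otimes> \<sigma> x \<otimes> \<sigma> (y \<otimes>\<^bsub>H\<^esub> z)"
    using assms by (simp add: G.m_assoc \<sigma>_mult)
  also have "\<dots> = \<sigma> x \<otimes> (\<sigma> y \<otimes> \<sigma> z)"
    using assms K_commutes[of "factor_set y z" "\<sigma> x"] by (simp add: G.m_assoc \<sigma>_mult)
  also have "\<dots> = factor_set x y \<otimes> (\<sigma> (x \<otimes>\<^bsub>H\<^esub> y) \<otimes> \<sigma> z)"
    using assms \<sigma>_mult[of x y] by (simp flip: G.m_assoc)
  also have "\<dots> = factor_set x y \<otimes> factor_set (x \<otimes>\<^bsub>H\<^esub> y) z \<otimes> \<sigma> (x \<otimes>\<^bsub>H\<^esub> (y \<otimes>\<^bsub>H\<^esub> z))"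
    using assms by (simp add: \<sigma>_mult G.m_assoc H.m_assoc)
  finally show ?thesis
    using assms K_commutes[of "factor_set x y" "factor_set (x \<otimes>\<^bsub>H\<^esub> y) z"] by simp
qed

text \<open>
  A map \<open>F\<close> on \<open>H\<close> that is multiplicative up to the values of a homomorphism \<open>\<mu>\<close> on the factor set,
  with \<open>\<mu>\<close> commuting with \<open>F\<close>, becomes a genuine homomorphism on \<open>G\<close>. It is used for
  \<open>L = \<complex>\<^sup>\<times>\<close>, to show that the transgression is injective, and for \<open>L = GL(V)\<close>, to linearize
  a projective representation of \<open>H\<close>.
\<close>

lemma lift_hom:
  assumes "group L" and \<mu>: "\<mu> \<in> hom (G\<lparr>carrier := K\<rparr>) L"
    and F: "\<And>x. x \<in> carrier H \<Longrightarrow> F x \<in> carrier L"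
    and comm: "\<And>a x. a \<in> K \<Longrightarrow> x \<in> carrier H \<Longrightarrow> F x \<otimes>\<^bsub>L\<^esub> \<mu> a = \<mu> a \<otimes>\<^bsub>L\<^esub> F x"
    and F_mult: "\<And>x y. x \<in> carrier H \<Longrightarrow> y \<in> carrier H \<Longrightarrow>
      F x \<otimes>\<^bsub>L\<^esub> F y = \<mu> (factor_set x y) \<otimes>\<^bsub>L\<^esub> F (x \<otimes>\<^bsub>H\<^esub> y)"
  shows "(\<lambda>g. \<mu> (\<kappa> g) \<otimes>\<^bsub>L\<^esub> F (\<theta> g)) \<in> hom G L"
proof -
  interpret L: group L by fact
  have \<mu>_closed [simp]: "\<mu> a \<in> carrier L" if "a \<in> K" for a
    using \<mu> that by (auto simp: hom_def)
  have \<mu>_mult: "\<mu> (a \<otimes> b) = \<mu> a \<otimes>\<^bsub>L\<^esub> \<mu> b" if "a \<in> K" "b \<in> K" for a b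
    using \<mu> that by (auto simp: hom_def)
  note [simp] = F
  show ?thesis
  proof (rule homI)
    fix g g' assume g: "g \<in> carrier G" "g' \<in> carrier G"
    have "\<mu> (\<kappa> (g \<otimes> g')) \<otimes>\<^bsub>L\<^esub> F (\<theta> (g \<otimes> g'))
        = \<mu> (\<kappa> g) \<otimes>\<^bsub>L\<^esub> \<mu> (\<kappa> g') \<otimes>\<^bsub>L\<^esub> (\<mu> (factor_set (\<theta> g) (\<theta> g')) \<otimes>\<^bsub>L\<^esub> F (\<theta> g \<otimes>\<^bsub>H\<^esub> \<theta> g'))"
      using g by (simp add: \<kappa>_mult \<mu>_mult L.m_assoc)
    also have "\<dots> = \<mu> (\<kappa> g) \<otimes>\<^bsub>L\<^esub> (\<mu> (\<kappa> g') \<otimes>\<^bsub>L\<^esub> F (\<theta> g)) \<otimes>\<^bsub>L\<^esub> F (\<theta> g')"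
      using g by (simp add: F_mult[symmetric] L.m_assoc)
    also have "\<dots> = (\<mu> (\<kappa> g) \<otimes>\<^bsub>L\<^esub> F (\<theta> g)) \<otimes>\<^bsub>L\<^esub> (\<mu> (\<kappa> g') \<otimes>\<^bsub>L\<^esub> F (\<theta> g'))"
      using g comm[of "\<kappa> g'" "\<theta> g", symmetric] by (simp add: L.m_assoc)
    finally show "\<mu> (\<kappa> (g \<otimes> g')) \<otimes>\<^bsub>L\<^esub> F (\<theta> (g \<otimes> g'))
        = (\<mu> (\<kappa> g) \<otimes>\<^bsub>L\<^esub> F (\<theta> g)) \<otimes>\<^bsub>L\<^esub> (\<mu> (\<kappa> g') \<otimes>\<^bsub>L\<^esub> F (\<theta> g'))" .
  qed simp
qed

text \<open>
  Two characters of \<open>K\<close> whose transgressions are cohomologous are equal: by \<open>lift_hom\<close> their quotient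
  extends to a homomorphism \<open>G \<rightarrow> \<complex>\<^sup>\<times>\<close>, which is trivial on the
  derived subgroup and hence on \<open>K\<close>.
\<close>

lemma transgression_injective:
  assumes der: "K \<subseteq> derived G (carrier G)"
    and \<chi>: "\<chi> \<in> characters_on G K" "\<chi>' \<in> characters_on G K"
    and c: "\<And>x. x \<in> carrier H \<Longrightarrow> c x \<noteq> 0"
    and eq: "\<And>x y. x \<in> carrier H \<Longrightarrow> y \<in> carrier H \<Longrightarrow>
      \<chi> (factor_set x y) * c (x \<otimes>\<^bsub>H\<^esub> y) = c x * c y * \<chi>' (factor_set x y)"
  shows "\<chi> = \<chi>'"
proof -
  define \<mu> where "\<mu> a = \<chi> a / \<chi>' a" for a
  have \<mu>_mult: "\<mu> (a \<otimes> b) = \<mu> a * \<mu> b" if "a \<in> K" "b \<in> K" for a b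
    using that \<chi> by (auto simp: \<mu>_def characters_on_iff)
  have "(\<lambda>g. \<mu> (\<kappa> g) \<otimes>\<^bsub>complex_units\<^esub> c (\<theta> g)) \<in> hom G complex_units"
  proof (rule lift_hom)
    show "group complex_units"
      using comm_group_complex_units by (simp add: comm_group_def)
    show "\<mu> \<in> hom (G\<lparr>carrier := K\<rparr>) complex_units"
      using \<chi> \<mu>_mult by (auto simp: hom_def complex_units_def characters_on_iff \<mu>_def)
    show "c x \<otimes>\<^bsub>complex_units\<^esub> c y = \<mu> (factor_set x y) \<otimes>\<^bsub>complex_units\<^esub> c (x \<otimes>\<^bsub>H\<^esub> y)"
      if "x \<in> carrier H" "y \<in> carrier H" for x y
    proof -
      have "\<chi>' (factor_set x y) \<noteq> 0" using \<chi> that by (simp add: characters_on_iff)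
      then show ?thesis using eq[OF that] by (simp add: complex_units_def \<mu>_def field_simps)
    qed
  qed (use c in \<open>simp_all add: complex_units_def mult.commute\<close>)
  then have one: "\<mu> (\<kappa> a) * c (\<theta> a) = 1" if "a \<in> K" for a
    using G.hom_complex_units_derived that der by (fastforce simp: complex_units_def)
  have \<mu>_one: "\<mu> a = 1" if a: "a \<in> K" for a
  proof -
    have \<theta>a: "\<theta> a = \<one>\<^bsub>H\<^esub>" using a by (rule \<theta>_K)
    have oneK: "\<one> \<in> K" by (rule subgroup.one_closed[OF subgroup_K])
    have "\<mu> a * (\<mu> (\<kappa> \<one>) * c \<one>\<^bsub>H\<^esub>) = 1"
      using one[OF a] \<kappa>_K[OF a] \<mu>_mult[OF a, of "\<kappa> \<one>"] \<theta>a
      by (simp add: mult.assoc)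
    then show ?thesis using one[OF oneK] by simp
  qed
  show ?thesis
  proof (rule extensionalityI)
    show "\<chi> \<in> extensional K" "\<chi>' \<in> extensional K" using \<chi> by (auto simp: characters_on_iff)
    show "\<chi> a = \<chi>' a" if "a \<in> K" for a
      using \<mu>_one[OF that] \<chi> that by (simp add: \<mu>_def characters_on_iff)
  qed
qed

text \<open>The 2-cocycle of \<open>H\<close> obtained by applying a character of \<open>K\<close> to the factor set.\<close>

definition transgression :: "('g \<Rightarrow> complex) \<Rightarrow> 'h \<times> 'h \<Rightarrow> complex" where
  "transgression \<chi> = (\<lambda>(x, y)\<in>carrier H \<times> carrier H. \<chi> (factor_set x y))"

lemma transgression_cocycle:
  assumes "\<chi> \<in> characters_on G K"
  shows "transgression \<chi> \<in> cocycles2 H complex_units"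
proof -
  have "\<chi> (factor_set y z) * \<chi> (factor_set x (y \<otimes>\<^bsub>H\<^esub> z)) = \<chi> (factor_set (x \<otimes>\<^bsub>H\<^esub> y) z) * \<chi> (factor_set x y)"
    if "x \<in> carrier H" "y \<in> carrier H" "z \<in> carrier H" for x y z
  proof -
    have mult: "\<chi> (a \<otimes> b) = \<chi> a * \<chi> b" if "a \<in> K" "b \<in> K" for a b
      using assms that by (simp add: characters_on_iff)
    show ?thesis
      using that factor_set_cocycle[OF that] by (simp flip: mult)
  qed
  then show ?thesis
    using assms
    by (auto simp: transgression_def cocycles2_def cochains2_def complex_units_def characters_on_iff)
qed

text \<open>
  For a Schur cover the transgression is surjective on cohomology classes: it is an injective map
  from the characters of \<open>K\<close>, of which there are at least \<open>card K\<close>, into \<open>H\<^sup>2(H, \<complex>\<^sup>\<times>)\<close>,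
  which has \<open>card K\<close> elements.
\<close>

lemma cocycle_cohomologous_to_transgression:
  assumes fin: "finite (carrier G)" and der: "K \<subseteq> derived G (carrier G)"
    and iso: "G\<lparr>carrier := K\<rparr> \<cong> H2 H complex_units"
    and \<beta>: "\<beta> \<in> cocycles2 H complex_units"
  obtains \<chi> c where "\<chi> \<in> characters_on G K" "\<And>x. x \<in> carrier H \<Longrightarrow> c x \<noteq> 0"
    "\<And>x y. x \<in> carrier H \<Longrightarrow> y \<in> carrier H \<Longrightarrow>
      \<beta> (x, y) * c (x \<otimes>\<^bsub>H\<^esub> y) = c x * c y * \<chi> (factor_set x y)"
proof -
  define Z where "Z = (cochains2 H complex_units)\<lparr>carrier := cocycles2 H complex_units\<rparr>"
  define B where "B = coboundaries2 H complex_units"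
  interpret Z: comm_group Z
    unfolding Z_def by (rule comm_group_cocycles2[OF H.group_axioms comm_group_complex_units])
  have B: "subgroup B Z"
    unfolding B_def Z_def
    by (rule normal_imp_subgroup[OF coboundaries2_normal[OF H.group_axioms comm_group_complex_units]])
  have H2: "H2 H complex_units = Z Mod B" by (simp add: H2_def Z_def B_def)
  have carrier_Z: "carrier Z = cocycles2 H complex_units" by (simp add: Z_def)
  \<comment> \<open>Equality of cosets, spelled out; the coboundary equation is written without division.\<close>
  have coset: "\<exists>c. (\<forall>x\<in>carrier H. c x \<noteq> 0) \<and> (\<forall>x\<in>carrier H. \<forall>y\<in>carrier H.
      f (x, y) * c (x \<otimes>\<^bsub>H\<^esub> y) = c x * c y * f' (x, y))"
    if f: "f \<in> carrier Z" and eq: "B #>\<^bsub>Z\<^esub> f = B #>\<^bsub>Z\<^esub> f'" for f f'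
  proof -
    have "f \<in> B #>\<^bsub>Z\<^esub> f'"
      using Z.rcos_self[OF f B] eq by simp
    then obtain c where c: "c \<in> carrier H \<rightarrow> carrier complex_units"
      and f_eq: "f = coboundary H complex_units c \<otimes>\<^bsub>Z\<^esub> f'"
      by (auto simp: r_coset_def B_def coboundaries2_def)
    have c0: "c x \<noteq> 0" if "x \<in> carrier H" for x
      using c that by (auto simp: complex_units_def)
    have "f (x, y) * c (x \<otimes>\<^bsub>H\<^esub> y) = c x * c y * f' (x, y)"
      if "x \<in> carrier H" "y \<in> carrier H" for x y
    proof -
      have "f (x, y) = c y * inv\<^bsub>complex_units\<^esub> c (x \<otimes>\<^bsub>H\<^esub> y) * c x * f' (x, y)"
        unfolding f_eq using that
        by (simp add: Z_def cochains2_def coboundary_def) (simp add: complex_units_def)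
      then show ?thesis
        using that c0[of "x \<otimes>\<^bsub>H\<^esub> y"] by (simp add: inv_complex_units field_simps)
    qed
    then show ?thesis using c0 by blast
  qed
  have finK: "finite K" using fin by (rule finite_subset[rotated]) auto
  have "comm_group (G\<lparr>carrier := K\<rparr>)"
    using K_commutes
    by (intro group.group_comm_groupI G.subgroup_imp_group subgroup_K) simp
  then obtain X where X: "finite X" "card K \<le> card X" "X \<subseteq> characters_on G K"
    using comm_group.finite_group_enough_characters[of "G\<lparr>carrier := K\<rparr>"] finK
    by (auto simp: characters_on_def)
  define \<Phi> where "\<Phi> \<chi> = B #>\<^bsub>Z\<^esub> transgression \<chi>" for \<chi>
  obtain h where "h \<in> iso (G\<lparr>carrier := K\<rparr>) (H2 H complex_units)"
    using iso by (auto simp: is_iso_def)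
  then have bij: "bij_betw h K (carrier (H2 H complex_units))"
    by (simp add: iso_def)
  have "inj_on \<Phi> X"
  proof (rule inj_onI)
    fix \<chi> \<chi>' assume "\<chi> \<in> X" "\<chi>' \<in> X" and eq: "\<Phi> \<chi> = \<Phi> \<chi>'"
    then have \<chi>: "\<chi> \<in> characters_on G K" "\<chi>' \<in> characters_on G K" using X(3) by auto
    have "transgression \<chi> \<in> carrier Z"
      using \<chi>(1) by (simp add: carrier_Z transgression_cocycle)
    from coset[OF this eq[unfolded \<Phi>_def]] obtain c where
      c: "\<forall>x\<in>carrier H. c x \<noteq> 0" "\<forall>x\<in>carrier H. \<forall>y\<in>carrier H.
        transgression \<chi> (x, y) * c (x \<otimes>\<^bsub>H\<^esub> y) = c x * c y * transgression \<chi>' (x, y)"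
      by blast
    show "\<chi> = \<chi>'"
      by (rule transgression_injective[OF der \<chi>, of c])
         (use c in \<open>auto simp: transgression_def\<close>)
  qed
  then have "card (\<Phi> ` X) = card X" by (rule card_image)
  moreover have sub: "\<Phi> ` X \<subseteq> carrier (H2 H complex_units)"
    using X(3) transgression_cocycle
    by (auto simp: H2 carrier_FactGroup carrier_Z \<Phi>_def)
  moreover have "finite (carrier (H2 H complex_units))" "card (carrier (H2 H complex_units)) = card K"
    using bij finK bij_betw_finite bij_betw_same_card by metis+
  ultimately have "\<Phi> ` X = carrier (H2 H complex_units)"
    using X(2) by (intro card_seteq) auto
  moreover have "B #>\<^bsub>Z\<^esub> \<beta> \<in> carrier (H2 H complex_units)"
    using \<beta> by (auto simp: H2 carrier_FactGroup carrier_Z)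
  ultimately obtain \<chi> where "\<chi> \<in> X" and eq: "B #>\<^bsub>Z\<^esub> \<beta> = B #>\<^bsub>Z\<^esub> transgression \<chi>"
    by (auto simp: \<Phi>_def)
  have "\<beta> \<in> carrier Z" using \<beta> by (simp add: carrier_Z)
  from coset[OF this eq] obtain c where
    "\<forall>x\<in>carrier H. c x \<noteq> 0" "\<forall>x\<in>carrier H. \<forall>y\<in>carrier H.
      \<beta> (x, y) * c (x \<otimes>\<^bsub>H\<^esub> y) = c x * c y * transgression \<chi> (x, y)"
    by blast
  then show ?thesis
    using that[of \<chi> c] \<open>\<chi> \<in> X\<close> X(3) by (auto simp: transgression_def)
qed

end


section \<open>Quandle representations of conjugation quandles\<close>

lemma GL_carrier_iff: "f \<in> carrier (GL s) \<longleftrightarrow> Vector_Spaces.linear s s f \<and> bij f"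
  by (simp add: GL_def)

lemma GL_mult: "f \<otimes>\<^bsub>GL s\<^esub> g = f \<circ> g"
  by (simp add: GL_def)

lemma GL_scale: "f \<in> carrier (GL s) \<Longrightarrow> f (s a v) = s a (f v)"
  by (simp add: GL_carrier_iff Vector_Spaces.linear_def module_hom.scale)

lemma scalar_in_GL:
  assumes "vector_space s" and c: "c \<noteq> 0"
  shows "s c \<in> carrier (GL s)"
proof -
  interpret vector_space s by fact
  have "bij (s c)"
    by (rule bij_betw_byWitness[where f' = "s (inverse c)"]) (use c in auto)
  moreover have "Vector_Spaces.linear s s (s c)"
    by unfold_locales (simp_all add: scale_right_distrib mult.commute)
  ultimately show ?thesis by (simp add: GL_carrier_iff)
qed

lemma quandle_rep_Conj_iff:
  assumes "group G" and vs: "vector_space s"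
  shows "quandle_rep s (Conj G) \<rho> \<longleftrightarrow>
    (\<forall>x\<in>carrier G. \<rho> x \<in> carrier (GL s)) \<and>
    (\<forall>x\<in>carrier G. \<forall>y\<in>carrier G. \<rho> (x \<otimes>\<^bsub>G\<^esub> y \<otimes>\<^bsub>G\<^esub> inv\<^bsub>G\<^esub> x) \<circ> \<rho> x = \<rho> x \<circ> \<rho> y)"
proof -
  interpret G: group G by fact
  interpret L: group "GL s" by (rule group_GL[OF vs])
  have "\<rho> (x \<otimes>\<^bsub>G\<^esub> y \<otimes>\<^bsub>G\<^esub> inv\<^bsub>G\<^esub> x) = \<rho> x \<otimes>\<^bsub>GL s\<^esub> \<rho> y \<otimes>\<^bsub>GL s\<^esub> inv\<^bsub>GL s\<^esub> (\<rho> x) \<longleftrightarrow>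
      \<rho> (x \<otimes>\<^bsub>G\<^esub> y \<otimes>\<^bsub>G\<^esub> inv\<^bsub>G\<^esub> x) \<circ> \<rho> x = \<rho> x \<circ> \<rho> y"
    if "\<forall>x\<in>carrier G. \<rho> x \<in> carrier (GL s)" "x \<in> carrier G" "y \<in> carrier G" for x y
    using that L.m_closed[of "\<rho> x" "\<rho> y"]
    by (subst L.inv_solve_right) (auto simp: GL_mult)
  then show ?thesis
    by (auto simp: quandle_rep_def Conj_def Pi_iff)
qed

text \<open>
  The factors \<open>c x\<close> need not be nonzero: a subspace invariant under \<open>\<rho>'\<close> is invariant under
  \<open>\<rho>\<close> in any case.
\<close>

lemma irreducible_action_rescale:
  assumes "vector_space s" and irr: "irreducible_action s X \<rho>"
    and eq: "\<And>x v. x \<in> X \<Longrightarrow> \<rho> x v = s (c x) (\<rho>' x v)"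
  shows "irreducible_action s X \<rho>'"
proof -
  interpret vector_space s by fact
  have "invariant_subspace s X \<rho> W" if "invariant_subspace s X \<rho>' W" for W
    using that subspace_scale by (fastforce simp: invariant_subspace_def eq)
  then show ?thesis using irr by (auto simp: irreducible_action_def)
qed

text \<open>
  In the relation \<open>\<rho> (x \<triangleright> y) \<circ> \<rho> x = \<rho> x \<circ> \<rho> y\<close> both sides are multiples of
  \<open>\<rho>' (x \<otimes> y)\<close>, with factors \<open>\<chi> (x \<triangleright> y) * \<chi> x\<close> and \<open>\<chi> y * \<chi> x\<close>.
\<close>

lemma twist_quandle_rep_iff:
  assumes "group G" and vs: "vector_space s" and hom: "\<rho>' \<in> hom G (GL s)"
    and nz: "\<And>x. x \<in> carrier G \<Longrightarrow> \<chi> x \<noteq> 0"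
    and eq: "\<And>x v. x \<in> carrier G \<Longrightarrow> \<rho> x v = s (\<chi> x) (\<rho>' x v)"
    and nontriv: "(UNIV :: 'v set) \<noteq> {0}"
  shows "quandle_rep s (Conj G) (\<rho> :: 'g \<Rightarrow> 'v::ab_group_add \<Rightarrow> 'v) \<longleftrightarrow> quandle_character (Conj G) \<chi>"
proof -
  interpret G: group G by fact
  interpret vector_space s by fact
  interpret L: group "GL s" by (rule group_GL[OF vs])
  have \<rho>'_GL: "\<rho>' x \<in> carrier (GL s)" if "x \<in> carrier G" for x
    using hom that by (auto simp: hom_def)
  have \<rho>'_mult: "\<rho>' (x \<otimes>\<^bsub>G\<^esub> y) v = \<rho>' x (\<rho>' y v)" if "x \<in> carrier G" "y \<in> carrier G" for x y v
    using hom that by (simp add: hom_def GL_mult)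
  have \<rho>'_scale: "\<rho>' x (s a v) = s a (\<rho>' x v)" if "x \<in> carrier G" for x a v
    using \<rho>'_GL[OF that] by (rule GL_scale)
  have "\<rho> x = s (\<chi> x) \<otimes>\<^bsub>GL s\<^esub> \<rho>' x" if "x \<in> carrier G" for x
    using eq[OF that] by (auto simp: GL_mult)
  then have \<rho>_GL: "\<rho> x \<in> carrier (GL s)" if "x \<in> carrier G" for x
    using that \<rho>'_GL scalar_in_GL[OF vs] nz by simp
  have "\<rho> (x \<otimes>\<^bsub>G\<^esub> y \<otimes>\<^bsub>G\<^esub> inv\<^bsub>G\<^esub> x) \<circ> \<rho> x = \<rho> x \<circ> \<rho> y \<longleftrightarrow> \<chi> (x \<otimes>\<^bsub>G\<^esub> y \<otimes>\<^bsub>G\<^esub> inv\<^bsub>G\<^esub> x) = \<chi> y"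
    if x: "x \<in> carrier G" and y: "y \<in> carrier G" for x y
  proof -
    let ?z = "x \<otimes>\<^bsub>G\<^esub> y \<otimes>\<^bsub>G\<^esub> inv\<^bsub>G\<^esub> x"
    have z: "?z \<in> carrier G" using x y by simp
    have "?z \<otimes>\<^bsub>G\<^esub> x = x \<otimes>\<^bsub>G\<^esub> y" using x y by (simp add: G.m_assoc)
    then have 1: "\<rho> ?z (\<rho> x v) = s (\<chi> ?z * \<chi> x) (\<rho>' (x \<otimes>\<^bsub>G\<^esub> y) v)" for v
      using \<rho>'_mult[OF z x, of v] by (simp add: eq[OF z] eq[OF x] \<rho>'_scale[OF z])
    have 2: "\<rho> x (\<rho> y v) = s (\<chi> y * \<chi> x) (\<rho>' (x \<otimes>\<^bsub>G\<^esub> y) v)" for v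
      by (simp add: eq[OF x] eq[OF y] \<rho>'_scale[OF x] \<rho>'_mult[OF x y] mult.commute)
    obtain w :: 'v where "w \<noteq> 0" using nontriv by auto
    have "bij (\<rho>' (x \<otimes>\<^bsub>G\<^esub> y))" using \<rho>'_GL x y by (simp add: GL_carrier_iff)
    then obtain v where v: "w = \<rho>' (x \<otimes>\<^bsub>G\<^esub> y) v" by (metis bij_pointE)
    show ?thesis
    proof
      assume "\<rho> ?z \<circ> \<rho> x = \<rho> x \<circ> \<rho> y"
      then have "s (\<chi> ?z * \<chi> x) w = s (\<chi> y * \<chi> x) w"
        unfolding v 1[symmetric] 2[symmetric] by (metis comp_apply)
      then show "\<chi> ?z = \<chi> y" using \<open>w \<noteq> 0\<close> nz[OF x] by simp
    qed (simp add: fun_eq_iff 1 2)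
  qed
  then have "quandle_rep s (Conj G) \<rho> \<longleftrightarrow>
      (\<forall>x\<in>carrier G. \<forall>y\<in>carrier G. \<chi> (x \<otimes>\<^bsub>G\<^esub> y \<otimes>\<^bsub>G\<^esub> inv\<^bsub>G\<^esub> x) = \<chi> y)"
    unfolding quandle_rep_Conj_iff[OF assms(1) vs] using \<rho>_GL by simp
  also have "\<dots> \<longleftrightarrow> quandle_character (Conj G) \<chi>"
    using nz by (auto simp: quandle_character_def Conj_def)
  finally show ?thesis .
qed

text \<open>An irreducible quandle representation of \<open>Conj G\<close> for a countable group \<open>G\<close>.\<close>

locale irreducible_Conj_rep = group G + vector_space s
  for G :: "('g, 'm) monoid_scheme" (structure)
    and s :: "complex \<Rightarrow> 'v::ab_group_add \<Rightarrow> 'v" +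
  fixes \<rho> :: "'g \<Rightarrow> 'v \<Rightarrow> 'v"
  assumes countable_carrier: "countable (carrier G)"
    and irreducible: "irreducible_quandle_rep s (Conj G) \<rho>"
begin

lemma vector_space_s: "vector_space s"
  by unfold_locales

sublocale L: group "GL s"
  by (rule group_GL[OF vector_space_s])

lemma irreducible_action: "irreducible_action s (carrier G) \<rho>"
  using irreducible by (simp add: irreducible_quandle_rep_def Conj_def)

lemma \<rho>_GL [simp]: "x \<in> carrier G \<Longrightarrow> \<rho> x \<in> carrier (GL s)"
  and \<rho>_conj: "x \<in> carrier G \<Longrightarrow> y \<in> carrier G \<Longrightarrow> \<rho> (x \<otimes> y \<otimes> inv x) (\<rho> x v) = \<rho> x (\<rho> y v)"
  using irreducible unfolding irreducible_quandle_rep_def quandle_rep_Conj_iff[OF is_group vector_space_s]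
  by (auto simp: fun_eq_iff)

lemma \<rho>_scale: "x \<in> carrier G \<Longrightarrow> \<rho> x (s a v) = s a (\<rho> x v)"
  by (simp add: GL_scale)

lemma \<rho>_inj: "x \<in> carrier G \<Longrightarrow> \<rho> x v = \<rho> x w \<longleftrightarrow> v = w"
  using \<rho>_GL[of x] by (auto simp: GL_carrier_iff bij_def inj_eq simp del: \<rho>_GL)

lemma nontrivial: "(UNIV :: 'v set) \<noteq> {0}"
  using irreducible_action by (simp add: irreducible_action_def)

lemma scale_\<rho>_cancel:
  assumes "x \<in> carrier G" "\<And>v. s a (\<rho> x v) = s b (\<rho> x v)"
  shows "a = b"
proof -
  obtain w :: 'v where "w \<noteq> 0" using nontrivial by auto
  have "bij (\<rho> x)" using \<rho>_GL[OF assms(1)] by (simp add: GL_carrier_iff del: \<rho>_GL)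
  then obtain v where "w = \<rho> x v" by (metis bij_pointE)
  then show ?thesis using assms(2)[of v] \<open>w \<noteq> 0\<close> by simp
qed

lemma commuting_scalar:
  assumes T: "T \<in> carrier (GL s)"
    and comm: "\<And>x v. x \<in> carrier G \<Longrightarrow> T (\<rho> x v) = \<rho> x (T v)"
  obtains c where "c \<noteq> 0" "T = s c"
proof -
  obtain c where c: "T = s c"
  proof (rule schur_dixmier[OF vector_space_s irreducible_action countable_carrier])
    show "Vector_Spaces.linear s s (\<rho> x)" if "x \<in> carrier G" for x
      using \<rho>_GL[OF that] by (simp add: GL_carrier_iff del: \<rho>_GL)
    show "Vector_Spaces.linear s s T" using T by (simp add: GL_carrier_iff)
  qed (use comm in blast)+
  moreover have "c \<noteq> 0"
  proof
    assume "c = 0"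
    then have "T v = T w" for v w by (simp add: c)
    then have "(v :: 'v) = w" for v w
      using T by (metis GL_carrier_iff bij_def inj_eq)
    then show False using nontrivial by auto
  qed
  ultimately show ?thesis using that by blast
qed

text \<open>
  Conjugation by \<open>\<rho> (x \<otimes> y)\<close> and conjugation by \<open>\<rho> x \<circ> \<rho> y\<close> act in the same way on all \<open>\<rho> z\<close>, so
  the two operators differ by an operator that commutes with all \<open>\<rho> z\<close>, that is, by a scalar.
\<close>

lemma \<rho>_projective:
  assumes x: "x \<in> carrier G" and y: "y \<in> carrier G"
  obtains c where "c \<noteq> 0" "\<And>v. \<rho> x (\<rho> y v) = s c (\<rho> (x \<otimes> y) v)"
proof -
  have xy: "x \<otimes> y \<in> carrier G" using x y by simp
  define T where "T = inv\<^bsub>GL s\<^esub> \<rho> (x \<otimes> y) \<otimes>\<^bsub>GL s\<^esub> (\<rho> x \<otimes>\<^bsub>GL s\<^esub> \<rho> y)"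
  have T: "T \<in> carrier (GL s)" using x y by (simp add: T_def)
  have "\<rho> (x \<otimes> y) \<otimes>\<^bsub>GL s\<^esub> T = \<rho> x \<otimes>\<^bsub>GL s\<^esub> \<rho> y"
    using x y by (simp add: T_def flip: L.m_assoc)
  then have \<rho>T: "\<rho> (x \<otimes> y) (T v) = \<rho> x (\<rho> y v)" for v
    by (simp add: GL_mult fun_eq_iff)
  have "T (\<rho> z v) = \<rho> z (T v)" if z: "z \<in> carrier G" for z v
  proof -
    have "x \<otimes> (y \<otimes> z \<otimes> inv y) \<otimes> inv x = x \<otimes> y \<otimes> z \<otimes> inv (x \<otimes> y)"
      using x y z by (simp add: m_assoc inv_mult_group)
    then have "\<rho> (x \<otimes> y) (T (\<rho> z v)) = \<rho> (x \<otimes> y \<otimes> z \<otimes> inv (x \<otimes> y)) (\<rho> x (\<rho> y v))"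
      using \<rho>_conj[of x "y \<otimes> z \<otimes> inv y" "\<rho> y v"] \<rho>_conj[OF y z, of v] x y z by (simp add: \<rho>T)
    also have "\<dots> = \<rho> (x \<otimes> y) (\<rho> z (T v))"
      using \<rho>_conj[OF xy z, of "T v"] by (simp add: \<rho>T)
    finally show ?thesis using \<rho>_inj[OF xy] by simp
  qed
  then obtain c where "c \<noteq> 0" "T = s c" using commuting_scalar[OF T] by blast
  then show ?thesis using that[of c] \<rho>T \<rho>_scale[OF xy] by metis
qed

lemma \<rho>_central:
  assumes k: "k \<in> group_center G"
  obtains c where "c \<noteq> 0" "\<rho> k = s c"
proof (rule commuting_scalar)
  have kG: "k \<in> carrier G" using k by (simp add: group_center_def)
  then show "\<rho> k \<in> carrier (GL s)" by simp
  show "\<rho> k (\<rho> x v) = \<rho> x (\<rho> k v)" if x: "x \<in> carrier G" for x v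
  proof -
    have "k \<otimes> x \<otimes> inv k = x"
      using k x kG by (simp add: group_center_def m_assoc)
    then show ?thesis using \<rho>_conj[OF kG x, of v] by simp
  qed
qed (use that in blast)

lemma \<rho>_central_mult:
  assumes k: "k \<in> group_center G" and g: "g \<in> carrier G"
  obtains c where "c \<noteq> 0" "\<And>v. \<rho> (k \<otimes> g) v = s c (\<rho> g v)"
proof -
  obtain a where a: "a \<noteq> 0" "\<rho> k = s a" using \<rho>_central[OF k] .
  have "k \<in> carrier G" using k by (simp add: group_center_def)
  then obtain b where b: "b \<noteq> 0" "\<And>v. \<rho> k (\<rho> g v) = s b (\<rho> (k \<otimes> g) v)"
    using \<rho>_projective g by metis
  have "\<rho> (k \<otimes> g) v = s (inverse b) (s b (\<rho> (k \<otimes> g) v))" for v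
    using b(1) by simp
  then have "\<rho> (k \<otimes> g) v = s (inverse b * a) (\<rho> g v)" for v
    by (simp add: a(2) flip: b(2))
  then show ?thesis using that[of "inverse b * a"] a(1) b(1) by simp
qed

end


section \<open>Linearization over a Schur cover\<close>

text \<open>
  Composing \<open>\<rho>\<close> with the section gives a projective representation of \<open>H\<close>. Its cocycle \<open>\<beta>\<close> is
  cohomologous to the transgression of a character \<open>\<chi>\<close> of \<open>K\<close>, so that after rescaling by \<open>c\<close> it
  becomes a representation of \<open>G\<close> on which \<open>K\<close> acts through \<open>\<chi>\<close>.
\<close>

lemma (in central_extension) irreducible_Conj_rep_linearizes:
  fixes s :: "complex \<Rightarrow> 'v::ab_group_add \<Rightarrow> 'v"
  assumes fin: "finite (carrier G)" and der: "K \<subseteq> derived G (carrier G)"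
    and iso: "G\<lparr>carrier := K\<rparr> \<cong> H2 H complex_units"
    and vs: "vector_space s" and irr: "irreducible_quandle_rep s (Conj G) \<rho>"
  obtains \<rho>' \<psi> where "\<rho>' \<in> hom G (GL s)" "\<And>g. g \<in> carrier G \<Longrightarrow> \<psi> g \<noteq> 0"
    "\<And>g v. g \<in> carrier G \<Longrightarrow> \<rho> g v = s (\<psi> g) (\<rho>' g v)"
proof -
  interpret vector_space s by fact
  interpret R: irreducible_Conj_rep G s \<rho>
    by unfold_locales (use fin irr in \<open>auto intro: countable_finite\<close>)
  have "\<exists>b. b \<noteq> 0 \<and> (\<forall>v. \<rho> (\<sigma> x) (\<rho> (\<sigma> y) v) = s b (\<rho> (\<sigma> (x \<otimes>\<^bsub>H\<^esub> y)) v))"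
    if x: "x \<in> carrier H" and y: "y \<in> carrier H" for x y
  proof -
    obtain a where a: "a \<noteq> 0" "\<And>v. \<rho> (\<sigma> x) (\<rho> (\<sigma> y) v) = s a (\<rho> (\<sigma> x \<otimes> \<sigma> y) v)"
      using R.\<rho>_projective[OF \<sigma>_closed[OF x] \<sigma>_closed[OF y]] by blast
    have "factor_set x y \<in> group_center G"
      using x y kernel_central by auto
    then obtain d where d: "d \<noteq> 0"
      "\<And>v. \<rho> (factor_set x y \<otimes> \<sigma> (x \<otimes>\<^bsub>H\<^esub> y)) v = s d (\<rho> (\<sigma> (x \<otimes>\<^bsub>H\<^esub> y)) v)"
      using R.\<rho>_central_mult[of "factor_set x y" "\<sigma> (x \<otimes>\<^bsub>H\<^esub> y)"] x y by auto
    show ?thesis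
      using a d \<sigma>_mult[OF x y] by (intro exI[of _ "a * d"]) simp
  qed
  then obtain b where b0: "\<And>x y. x \<in> carrier H \<Longrightarrow> y \<in> carrier H \<Longrightarrow> b x y \<noteq> 0"
    and b: "\<And>x y v. x \<in> carrier H \<Longrightarrow> y \<in> carrier H \<Longrightarrow>
      \<rho> (\<sigma> x) (\<rho> (\<sigma> y) v) = s (b x y) (\<rho> (\<sigma> (x \<otimes>\<^bsub>H\<^esub> y)) v)"
    by metis
  define \<beta> where "\<beta> = (\<lambda>(x, y)\<in>carrier H \<times> carrier H. b x y)"
  \<comment> \<open>The cocycle identity results from evaluating \<open>\<rho> (\<sigma> x) \<circ> \<rho> (\<sigma> y) \<circ> \<rho> (\<sigma> z)\<close> in two ways.\<close>
  have "b y z * b x (y \<otimes>\<^bsub>H\<^esub> z) = b (x \<otimes>\<^bsub>H\<^esub> y) z * b x y"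
    if xyz: "x \<in> carrier H" "y \<in> carrier H" "z \<in> carrier H" for x y z
  proof (rule R.scale_\<rho>_cancel)
    show "\<sigma> (x \<otimes>\<^bsub>H\<^esub> y \<otimes>\<^bsub>H\<^esub> z) \<in> carrier G" using xyz by simp
    fix v
    have "s (b y z * b x (y \<otimes>\<^bsub>H\<^esub> z)) (\<rho> (\<sigma> (x \<otimes>\<^bsub>H\<^esub> y \<otimes>\<^bsub>H\<^esub> z)) v) = \<rho> (\<sigma> x) (\<rho> (\<sigma> y) (\<rho> (\<sigma> z) v))"
      using xyz by (simp add: b R.\<rho>_scale H.m_assoc mult.commute)
    also have "\<dots> = s (b (x \<otimes>\<^bsub>H\<^esub> y) z * b x y) (\<rho> (\<sigma> (x \<otimes>\<^bsub>H\<^esub> y \<otimes>\<^bsub>H\<^esub> z)) v)"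
      using b[of x y "\<rho> (\<sigma> z) v"] b[of "x \<otimes>\<^bsub>H\<^esub> y" z v] xyz by (simp add: mult.commute)
    finally show "s (b y z * b x (y \<otimes>\<^bsub>H\<^esub> z)) (\<rho> (\<sigma> (x \<otimes>\<^bsub>H\<^esub> y \<otimes>\<^bsub>H\<^esub> z)) v) =
        s (b (x \<otimes>\<^bsub>H\<^esub> y) z * b x y) (\<rho> (\<sigma> (x \<otimes>\<^bsub>H\<^esub> y \<otimes>\<^bsub>H\<^esub> z)) v)" .
  qed
  then have "\<beta> \<in> cocycles2 H complex_units"
    using b0 by (auto simp: \<beta>_def cocycles2_def cochains2_def complex_units_def)
  then obtain \<chi> c where \<chi>: "\<chi> \<in> characters_on G K"
    and c: "\<And>x. x \<in> carrier H \<Longrightarrow> c x \<noteq> 0"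
    and \<beta>: "\<And>x y. x \<in> carrier H \<Longrightarrow> y \<in> carrier H \<Longrightarrow>
      \<beta> (x, y) * c (x \<otimes>\<^bsub>H\<^esub> y) = c x * c y * \<chi> (factor_set x y)"
    using cocycle_cohomologous_to_transgression[OF fin der iso] by blast
  have \<chi>0: "\<chi> a \<noteq> 0" if "a \<in> K" for a
    using \<chi> that by (simp add: characters_on_iff)
  have bc: "b x y / (c x * c y) = \<chi> (factor_set x y) / c (x \<otimes>\<^bsub>H\<^esub> y)"
    if "x \<in> carrier H" "y \<in> carrier H" for x y
    using \<beta>[OF that] that c[OF that(1)] c[OF that(2)] c[of "x \<otimes>\<^bsub>H\<^esub> y"]
    by (simp add: \<beta>_def field_simps)
  define F where "F x = s (inverse (c x)) \<otimes>\<^bsub>GL s\<^esub> \<rho> (\<sigma> x)" for x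
  have F: "F x v = s (inverse (c x)) (\<rho> (\<sigma> x) v)" for x v
    by (simp add: F_def GL_mult)
  define \<rho>' where "\<rho>' g = s (\<chi> (\<kappa> g)) \<otimes>\<^bsub>GL s\<^esub> F (\<theta> g)" for g
  have "\<rho>' \<in> hom G (GL s)"
    unfolding \<rho>'_def
  proof (rule lift_hom)
    show "group (GL s)" by (rule group_GL[OF vs])
    show "(\<lambda>a. s (\<chi> a)) \<in> hom (G\<lparr>carrier := K\<rparr>) (GL s)"
      using \<chi> \<chi>0 by (auto simp: hom_def GL_mult fun_eq_iff characters_on_iff intro: scalar_in_GL[OF vs])
    show "F x \<in> carrier (GL s)" if "x \<in> carrier H" for x
      using that c scalar_in_GL[OF vs] by (simp add: F_def)
    show "F x \<otimes>\<^bsub>GL s\<^esub> s (\<chi> a) = s (\<chi> a) \<otimes>\<^bsub>GL s\<^esub> F x" if "a \<in> K" "x \<in> carrier H" for a x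
      using that by (simp add: GL_mult fun_eq_iff F R.\<rho>_scale mult.commute)
    show "F x \<otimes>\<^bsub>GL s\<^esub> F y = s (\<chi> (factor_set x y)) \<otimes>\<^bsub>GL s\<^esub> F (x \<otimes>\<^bsub>H\<^esub> y)"
      if x: "x \<in> carrier H" and y: "y \<in> carrier H" for x y
    proof
      fix v
      have "(F x \<otimes>\<^bsub>GL s\<^esub> F y) v = s (b x y / (c x * c y)) (\<rho> (\<sigma> (x \<otimes>\<^bsub>H\<^esub> y)) v)"
        using x y by (simp add: GL_mult F R.\<rho>_scale b field_simps)
      then show "(F x \<otimes>\<^bsub>GL s\<^esub> F y) v = (s (\<chi> (factor_set x y)) \<otimes>\<^bsub>GL s\<^esub> F (x \<otimes>\<^bsub>H\<^esub> y)) v"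
        unfolding bc[OF x y] by (simp add: GL_mult F divide_inverse)
    qed
  qed
  moreover have "\<exists>d. d \<noteq> 0 \<and> (\<forall>v. \<rho> g v = s d (\<rho>' g v))" if g: "g \<in> carrier G" for g
  proof -
    have \<theta>g: "\<theta> g \<in> carrier H" using g by simp
    have "\<kappa> g \<in> group_center G" using g kernel_central by auto
    then obtain d where d: "d \<noteq> 0" "\<And>v. \<rho> (\<kappa> g \<otimes> \<sigma> (\<theta> g)) v = s d (\<rho> (\<sigma> (\<theta> g)) v)"
      using R.\<rho>_central_mult[of "\<kappa> g" "\<sigma> (\<theta> g)"] g by auto
    have nz: "\<chi> (\<kappa> g) \<noteq> 0" "c (\<theta> g) \<noteq> 0" using \<chi>0 c g by auto
    have "\<rho> g v = s (d * c (\<theta> g) / \<chi> (\<kappa> g)) (\<rho>' g v)" for v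
      using d(2)[of v] nz by (simp add: \<kappa>_decomp[OF g] \<rho>'_def GL_mult F)
    then show ?thesis using d(1) nz by (intro exI[of _ "d * c (\<theta> g) / \<chi> (\<kappa> g)"]) simp
  qed
  then obtain \<psi> where "\<And>g. g \<in> carrier G \<Longrightarrow> \<psi> g \<noteq> 0" "\<And>g v. g \<in> carrier G \<Longrightarrow> \<rho> g v = s (\<psi> g) (\<rho>' g v)"
    by metis
  ultimately show ?thesis using that by blast
qed

theorem theorem2p15:
  fixes G :: "('g, 'm) monoid_scheme"
    and H :: "('h, 'n) monoid_scheme"
    and s :: "complex \<Rightarrow> 'v::ab_group_add \<Rightarrow> 'v"
    and \<rho> :: "'g \<Rightarrow> 'v \<Rightarrow> 'v"
  assumes "group G" and "finite (carrier G)"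
    and "schur_cover G H"
    and "vector_space s"
  shows "irreducible_quandle_rep s (Conj G) \<rho> \<longleftrightarrow>
    (\<exists>\<rho>' \<chi>. irreducible_group_rep s G \<rho>' \<and> quandle_character (Conj G) \<chi> \<and>
       (\<forall>x\<in>carrier G. \<rho> x = twist s \<chi> \<rho>' x))"
proof
  interpret vector_space s by fact
  assume irr: "irreducible_quandle_rep s (Conj G) \<rho>"
  then have rep: "quandle_rep s (Conj G) \<rho>" and act: "irreducible_action s (carrier G) \<rho>"
    by (simp_all add: irreducible_quandle_rep_def Conj_def)
  obtain \<theta> where H: "group H" and \<theta>: "\<theta> \<in> epi G H"
    and ker: "kernel G H \<theta> \<subseteq> group_center G" "kernel G H \<theta> \<subseteq> derived G (carrier G)"
      "G\<lparr>carrier := kernel G H \<theta>\<rparr> \<cong> H2 H complex_units"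
    using assms(3) by (auto simp: schur_cover_def)
  define \<sigma> where "\<sigma> = inv_into (carrier G) \<theta>"
  have im: "\<theta> ` carrier G = carrier H" and hom: "\<theta> \<in> hom G H"
    using \<theta> by (auto simp: epi_def)
  have "\<sigma> h \<in> carrier G" "\<theta> (\<sigma> h) = h" if "h \<in> carrier H" for h
    unfolding \<sigma>_def using that by (simp_all add: im inv_into_into f_inv_into_f)
  then interpret E: central_extension G H \<theta> \<sigma>
    using assms(1) H hom ker(1) by (simp add: central_extension_def central_extension_axioms_def)
  obtain \<rho>' \<psi> where \<rho>': "\<rho>' \<in> hom G (GL s)" and \<psi>: "\<And>g. g \<in> carrier G \<Longrightarrow> \<psi> g \<noteq> 0"
    and eq: "\<And>g v. g \<in> carrier G \<Longrightarrow> \<rho> g v = s (\<psi> g) (\<rho>' g v)"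
    using E.irreducible_Conj_rep_linearizes[OF assms(2) ker(2,3) assms(4) irr] by blast
  have "irreducible_group_rep s G \<rho>'"
    using \<rho>' irreducible_action_rescale[OF assms(4) act eq] by (simp add: irreducible_group_rep_def)
  moreover have "quandle_character (Conj G) \<psi>"
    using twist_quandle_rep_iff[OF assms(1,4) \<rho>' \<psi> eq] rep act
    by (simp add: irreducible_action_def)
  ultimately show "\<exists>\<rho>' \<chi>. irreducible_group_rep s G \<rho>' \<and> quandle_character (Conj G) \<chi> \<and>
       (\<forall>x\<in>carrier G. \<rho> x = twist s \<chi> \<rho>' x)"
    using eq by (intro exI[of _ \<rho>'] exI[of _ \<psi>]) (auto simp: twist_def)
next
  interpret vector_space s by fact
  assume "\<exists>\<rho>' \<chi>. irreducible_group_rep s G \<rho>' \<and> quandle_character (Conj G) \<chi> \<and>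
       (\<forall>x\<in>carrier G. \<rho> x = twist s \<chi> \<rho>' x)"
  then obtain \<rho>' \<chi> where \<rho>': "\<rho>' \<in> hom G (GL s)" "irreducible_action s (carrier G) \<rho>'"
    and \<chi>: "quandle_character (Conj G) \<chi>"
    and eq: "\<And>x v. x \<in> carrier G \<Longrightarrow> \<rho> x v = s (\<chi> x) (\<rho>' x v)"
    by (auto simp: irreducible_group_rep_def twist_def)
  have nz: "\<chi> x \<noteq> 0" if "x \<in> carrier G" for x
    using \<chi> that by (auto simp: quandle_character_def Conj_def)
  have "\<rho>' x v = s (inverse (\<chi> x)) (\<rho> x v)" if "x \<in> carrier G" for x v
    using nz[OF that] by (simp add: eq[OF that])
  then have "irreducible_action s (carrier G) \<rho>"
    by (rule irreducible_action_rescale[OF assms(4) \<rho>'(2)])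
  moreover have "quandle_rep s (Conj G) \<rho>"
    using twist_quandle_rep_iff[OF assms(1,4) \<rho>'(1) nz eq] \<chi> \<rho>'(2)
    by (simp add: irreducible_action_def)
  ultimately show "irreducible_quandle_rep s (Conj G) \<rho>"
    by (simp add: irreducible_quandle_rep_def Conj_def)
qed

end
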